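(* Every graph $H$ that has a governing block is deletion-normal.
   Context: All graphs are finite, without loops or parallel edges. A graph $G$ is $H$-free if it has no induced subgraph isomorphic to $H$. A graph $G$ is $H$-deletion-saturated if $G$ is $H$-free, $E(G)\neq\varnothing$, and for every edge $e\in E(G)$ the graph $G-e$ is not $H$-free. A graph $H$ is deletion-normal if there exists a (finite) $H$-deletion-saturated graph. A block of a graph $G$ is a maximal $2$-connected induced subgraph of $G$, where complete graphs on one or two vertices are considered $2$-connected; $\mathcal{B}(G)$ denotes the set of all blocks of $G$. A graph $F$ is omnipresent in a graph $G$ if for every $u\in V(F)$ and every $v\in V(G)$ there is an injection $\psi:V(F)\to V(G)$ with $\psi(u)=v$ such that $\psi$ is an isomorphism between $F$ and the induced subgraph $G[\psi(V(F))]$. A block $B$ of a graph $H$ is governing if there is a $B$-deletion-saturated graph $W$ such that every block $B'\in\mathcal{B}(H)\setminus\{B\}$ is omnipresent in $W$. *)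

theory Defs
  imports Main
begin

text \<open>Undirected graphs; an edge is the two-element set of its endpoints.\<close>

record 'a ugraph =
  verts :: "'a set"
  edges :: "'a set set"

definition simple_graph :: "'a ugraph \<Rightarrow> bool" where
  "simple_graph G \<longleftrightarrow> finite (verts G) \<and>
     (\<forall>e\<in>edges G. \<exists>u\<in>verts G. \<exists>v\<in>verts G. u \<noteq> v \<and> e = {u, v})"

definition induced :: "'a ugraph \<Rightarrow> 'a set \<Rightarrow> 'a ugraph" where
  "induced G S = \<lparr>verts = S, edges = {e \<in> edges G. e \<subseteq> S}\<rparr>"

definition del_edge :: "'a ugraph \<Rightarrow> 'a set \<Rightarrow> 'a ugraph" where
  "del_edge G e = \<lparr>verts = verts G, edges = edges G - {e}\<rparr>"

definition graph_isomorphism :: "('a \<Rightarrow> 'b) \<Rightarrow> 'a ugraph \<Rightarrow> 'b ugraph \<Rightarrow> bool" where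
  "graph_isomorphism \<psi> F G \<longleftrightarrow> bij_betw \<psi> (verts F) (verts G) \<and>
     (\<forall>u\<in>verts F. \<forall>v\<in>verts F. {u, v} \<in> edges F \<longleftrightarrow> {\<psi> u, \<psi> v} \<in> edges G)"

definition induced_free :: "'a ugraph \<Rightarrow> 'b ugraph \<Rightarrow> bool" where
  "induced_free H G \<longleftrightarrow>
     \<not> (\<exists>S \<psi>. S \<subseteq> verts G \<and> graph_isomorphism \<psi> H (induced G S))"

definition deletion_saturated :: "'a ugraph \<Rightarrow> 'b ugraph \<Rightarrow> bool" where
  "deletion_saturated H G \<longleftrightarrow> simple_graph G \<and> induced_free H G \<and> edges G \<noteq> {} \<and>
     (\<forall>e\<in>edges G. \<not> induced_free H (del_edge G e))"

text \<open>Existentially quantified finite graphs have vertices in \<^typ>\<open>nat\<close>; every finite graph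
  is isomorphic to such a graph, so this loses no generality.\<close>

definition deletion_normal :: "'a ugraph \<Rightarrow> bool" where
  "deletion_normal H \<longleftrightarrow> (\<exists>G :: nat ugraph. deletion_saturated H G)"

definition connected_graph :: "'a ugraph \<Rightarrow> bool" where
  "connected_graph G \<longleftrightarrow> verts G \<noteq> {} \<and>
     (\<forall>u\<in>verts G. \<forall>v\<in>verts G. (u, v) \<in> {(x, y). {x, y} \<in> edges G}\<^sup>*)"

definition complete_graph :: "'a ugraph \<Rightarrow> bool" where
  "complete_graph G \<longleftrightarrow>
     (\<forall>u\<in>verts G. \<forall>v\<in>verts G. u \<noteq> v \<longrightarrow> {u, v} \<in> edges G)"

text \<open>By convention, complete graphs on one or two vertices are 2-connected; the graph without
  vertices is not.\<close>

definition two_connected :: "'a ugraph \<Rightarrow> bool" where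
  "two_connected G \<longleftrightarrow>
     card (verts G) \<in> {1, 2} \<and> complete_graph G \<or>
     card (verts G) \<ge> 3 \<and> connected_graph G \<and>
       (\<forall>v\<in>verts G. connected_graph (induced G (verts G - {v})))"

text \<open>Blocks are actual subgraphs, not isomorphism types: distinct isomorphic blocks are
  distinct elements of this set.\<close>

definition blocks :: "'a ugraph \<Rightarrow> 'a ugraph set" where
  "blocks G = {induced G S | S. S \<subseteq> verts G \<and> two_connected (induced G S) \<and>
     (\<forall>T. S \<subset> T \<and> T \<subseteq> verts G \<longrightarrow> \<not> two_connected (induced G T))}"

definition omnipresent :: "'a ugraph \<Rightarrow> 'b ugraph \<Rightarrow> bool" where
  "omnipresent F G \<longleftrightarrow> (\<forall>u\<in>verts F. \<forall>v\<in>verts G.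
     \<exists>\<psi>. inj_on \<psi> (verts F) \<and> \<psi> ` verts F \<subseteq> verts G \<and> \<psi> u = v \<and>
         graph_isomorphism \<psi> F (induced G (\<psi> ` verts F)))"

definition governing_block :: "'a ugraph \<Rightarrow> 'a ugraph \<Rightarrow> bool" where
  "governing_block H B \<longleftrightarrow> B \<in> blocks H \<and>
     (\<exists>W :: nat ugraph. deletion_saturated B W \<and> (\<forall>B'\<in>blocks H - {B}. omnipresent B' W))"

end

theory Submission
  imports Defs
begin

text \<open>The governing block \<open>B\<close> comes with a \<open>B\<close>-deletion-saturated graph \<open>W\<close> in which every other block of
  \<open>H\<close> is omnipresent. Take many copies of \<open>W\<close> and identify vertices of different copies so
  that each vertex lies in many copies and the copies are arranged without short cycles: they are
  placed on the hyperedges of a uniform hypergraph of large degree and large girth. The resulting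
  graph \<open>G\<close> is \<open>H\<close>-deletion-saturated.

  \<^item> \<open>G\<close> contains no induced \<open>H\<close>, because it contains no induced \<open>B\<close>: as \<open>B\<close> is 2-connected and small
    compared with the girth, a copy of \<open>B\<close> would have to lie within a single copy of \<open>W\<close> (lemmas
    \<open>biconn_in_part\<close> and \<open>induced_free_glue\<close>).

  \<^item> If an edge \<open>e\<close> is deleted, then the copy of \<open>W\<close> that contained it acquires an induced \<open>B\<close>. This
    extends to an induced \<open>H\<close> in \<open>G - e\<close>, one block at a time. A block attached to
    the part built so far at a vertex \<open>v\<close> is found, by omnipresence, in an unused copy of \<open>W\<close> through
    the image of \<open>v\<close>; such a copy exists as the degree is large, and by the large girth it
    has nothing else in common with the part built so far, nor is it joined to it
    (lemmas \<open>placed_add_block\<close>, \<open>placed_add_vertex\<close>, \<open>placed_extend\<close>).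

  The hypergraph is obtained by starting from identical hyperedges and repeatedly passing to
  a finite covering that increases the girth (\<open>sparse_hypergraph_exists\<close>). For the extension it matters that
  blocks can be added in an order in which each new one meets the union of its predecessors in
  at most one vertex; the invariant \<open>tree_closed\<close> expresses this, and rests on the fact that a
  2-connected set stays 2-connected when an ear is added (\<open>biconn_ear\<close>).\<close>

section \<open>Uniform hypergraphs without short cycles\<close>

text \<open>A hypergraph is a family \<open>P\<close> of point sets indexed by its hyperedges. It has no short cycles
  iff each small subfamily has a leaf: take a shortest cycle for one direction, and for the other a
  bipartite incidence graph of minimum degree 2. The notion below is used instead of cycles because
  the gluing arguments only ever remove or inspect leaves.\<close>
definition leaf :: "('e \<Rightarrow> 'v set) \<Rightarrow> 'e set \<Rightarrow> 'e \<Rightarrow> bool" where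
  "leaf P F f \<longleftrightarrow>
     (\<forall>p\<in>P f \<inter> (\<Union>g\<in>F - {f}. P g). \<forall>q\<in>P f \<inter> (\<Union>g\<in>F - {f}. P g). p = q)"

text \<open>The leaf can be chosen different from any given root \<open>r\<close>, as a tree with at least two nodes has
  two leaves. This rooted form is what survives the induction on \<open>L\<close>. A family rather than a set of
  hyperedges permits hyperedges with the same points, which the starting point of that
  induction has.\<close>
locale sparse_hypergraph =
  fixes n d L :: nat and E :: "'e set" and P :: "'e \<Rightarrow> 'v set"
  assumes finite_E: "finite E" and E_nonempty: "E \<noteq> {}"
    and finite_P: "f \<in> E \<Longrightarrow> finite (P f)"
    and card_P: "f \<in> E \<Longrightarrow> card (P f) = n"
    and degree: "\<lbrakk>f \<in> E; p \<in> P f\<rbrakk> \<Longrightarrow> d \<le> card {g \<in> E. p \<in> P g}"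
    and leaf_exists:
      "\<lbrakk>F \<subseteq> E; r \<in> F; 2 \<le> card F; card F \<le> L\<rbrakk> \<Longrightarrow> \<exists>f\<in>F - {r}. leaf P F f"

lemma leaf_image:
  assumes a: "inj_on a E" and b: "inj_on b (\<Union>f\<in>E. P f)"
    and F: "F \<subseteq> E" and f: "f \<in> F" and leaf: "leaf P F f"
  shows "leaf (\<lambda>k. b ` P (inv_into E a k)) (a ` F) (a f)"
proof -
  have inv: "inv_into E a (a g) = g" if "g \<in> F" for g
    using a F that by (auto intro: inv_into_f_f)
  have diff: "a ` F - {a f} = a ` (F - {f})"
    using a F f by (auto simp: inj_on_def)
  have "(\<Union>k\<in>a ` F - {a f}. b ` P (inv_into E a k)) = b ` (\<Union>g\<in>F - {f}. P g)"
    unfolding diff using inv by auto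
  moreover have "b ` P f \<inter> b ` (\<Union>g\<in>F - {f}. P g) = b ` (P f \<inter> (\<Union>g\<in>F - {f}. P g))"
    using F f by (intro inj_on_image_Int[OF b, symmetric]) auto
  ultimately have "b ` P (inv_into E a (a f)) \<inter> (\<Union>k\<in>a ` F - {a f}. b ` P (inv_into E a k)) =
      b ` (P f \<inter> (\<Union>g\<in>F - {f}. P g))"
    using inv[OF f] by simp
  moreover have "\<forall>p\<in>b ` X. \<forall>q\<in>b ` X. p = q" if "\<forall>p\<in>X. \<forall>q\<in>X. p = q" for X
    using that by auto
  ultimately show ?thesis using leaf unfolding leaf_def by metis
qed

text \<open>The lifts below change the type of hyperedges and points. Renaming both by natural numbers
  makes them iterable.\<close>
lemma sparse_hypergraph_on_nat:
  assumes "sparse_hypergraph n d L (E :: 'e set) (P :: 'e \<Rightarrow> 'v set)"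
  shows "\<exists>(E' :: nat set) (P' :: nat \<Rightarrow> nat set). sparse_hypergraph n d L E' P'"
proof -
  interpret sparse_hypergraph n d L E P by fact
  obtain a :: "'e \<Rightarrow> nat" where a: "inj_on a E"
    using finite_imp_inj_to_nat_seg[OF finite_E] by blast
  have fin: "finite (\<Union>f\<in>E. P f)" using finite_E finite_P by auto
  obtain b :: "'v \<Rightarrow> nat" where b: "inj_on b (\<Union>f\<in>E. P f)"
    using finite_imp_inj_to_nat_seg[OF fin] by blast
  define P' where "P' k = b ` P (inv_into E a k)" for k
  have P': "P' (a f) = b ` P f" if "f \<in> E" for f
    using that a by (simp add: P'_def)
  have inj: "inj_on b (P f)" if "f \<in> E" for f
    using b that by (auto simp: inj_on_def)
  have "sparse_hypergraph n d L (a ` E) P'"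
  proof
    fix k p assume "k \<in> a ` E" "p \<in> P' k"
    then obtain f q where f: "f \<in> E" "k = a f" and q: "q \<in> P f" "p = b q"
      using P' by auto
    have "b q \<in> b ` P g \<longleftrightarrow> q \<in> P g" if "g \<in> E" for g
      using that f q b by (auto dest: inj_onD)
    then have "{g \<in> a ` E. p \<in> P' g} = a ` {g \<in> E. q \<in> P g}"
      using P' q(2) by auto
    moreover have "card (a ` {g \<in> E. q \<in> P g}) = card {g \<in> E. q \<in> P g}"
      by (rule card_image) (use a in \<open>auto simp: inj_on_def\<close>)
    ultimately show "d \<le> card {g \<in> a ` E. p \<in> P' g}"
      using degree[OF f(1) q(1)] by simp
  next
    fix F r assume F: "F \<subseteq> a ` E" "r \<in> F" "2 \<le> card F" "card F \<le> L"
    then obtain F0 where F0: "F0 \<subseteq> E" "F = a ` F0" by (meson subset_imageE)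
    then obtain r0 where r0: "r0 \<in> F0" "r = a r0" using F by auto
    have injF: "inj_on a F0" using a F0 by (meson inj_on_subset)
    then have "card F = card F0" using F0 by (simp add: card_image)
    then obtain f where f: "f \<in> F0 - {r0}" "leaf P F0 f"
      using leaf_exists[OF F0(1) r0(1)] F by auto
    then have "leaf P' F (a f)"
      using leaf_image[OF a b F0(1)] F0 by (simp add: P'_def[abs_def])
    moreover have "a f \<in> F - {r}" using f r0 F0 injF by (auto simp: inj_on_def)
    ultimately show "\<exists>f\<in>F - {r}. leaf P' F f" by blast
  qed (use finite_E E_nonempty finite_P card_P P' inj in \<open>auto simp: card_image\<close>)
  then show ?thesis by blast
qed

text \<open>The lift of a hypergraph: hyperedges and points each carry a set of incidences \<open>(f, p)\<close>, and going
  from a hyperedge \<open>f\<close> to its point \<open>p\<close> toggles the incidence \<open>(f, p)\<close>. In terms of the incidence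
  graph this is the covering with fibre the vector space over the two-element field that is spanned
  by the edges. A closed walk in the covering traverses each edge below an even number of times,
  so a shortest cycle below does not lift to a closed walk: the girth grows.\<close>
definition lift_points :: "('e \<Rightarrow> 'v set) \<Rightarrow> 'e \<times> ('e \<times> 'v) set \<Rightarrow> ('v \<times> ('e \<times> 'v) set) set" where
  "lift_points P k = (\<lambda>p. (p, sym_diff (snd k) {(fst k, p)})) ` P (fst k)"

lemma not_leaf_lift:
  assumes "\<not> leaf (lift_points P) F k"
  obtains p q g h where "p \<noteq> q" "p \<in> P (fst k)" "q \<in> P (fst k)"
    "g \<in> F - {k}" "p \<in> P (fst g)" "sym_diff (snd k) {(fst k, p)} = sym_diff (snd g) {(fst g, p)}"
    "h \<in> F - {k}" "q \<in> P (fst h)" "sym_diff (snd k) {(fst k, q)} = sym_diff (snd h) {(fst h, q)}"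
proof -
  obtain p' q' where pq: "p' \<noteq> q'" "p' \<in> lift_points P k" "q' \<in> lift_points P k"
    "p' \<in> (\<Union>g\<in>F - {k}. lift_points P g)" "q' \<in> (\<Union>g\<in>F - {k}. lift_points P g)"
    using assms unfolding leaf_def by blast
  obtain p where p: "p' = (p, sym_diff (snd k) {(fst k, p)})" "p \<in> P (fst k)"
    using pq(2) unfolding lift_points_def by blast
  obtain q where q: "q' = (q, sym_diff (snd k) {(fst k, q)})" "q \<in> P (fst k)"
    using pq(3) unfolding lift_points_def by blast
  obtain g where g: "g \<in> F - {k}" "p' \<in> lift_points P g" using pq(4) by blast
  obtain h where h: "h \<in> F - {k}" "q' \<in> lift_points P h" using pq(5) by blast
  have "p \<in> P (fst g)" "sym_diff (snd k) {(fst k, p)} = sym_diff (snd g) {(fst g, p)}"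
    using g(2) p(1) unfolding lift_points_def by auto
  moreover have "q \<in> P (fst h)" "sym_diff (snd k) {(fst k, q)} = sym_diff (snd h) {(fst h, q)}"
    using h(2) q(1) unfolding lift_points_def by auto
  moreover have "p \<noteq> q" using pq(1) p(1) q(1) by auto
  ultimately show thesis using that g(1) h(1) p(2) q(2) by metis
qed

lemma meet_lift_distinct:
  assumes "sym_diff (snd k) {(fst k, p)} = sym_diff (snd g) {(fst g, p)}" "g \<noteq> k"
  shows "fst g \<noteq> fst k"
proof
  assume eq: "fst g = fst k"
  have "snd g = snd k" using assms(1) unfolding eq by blast
  with eq assms(2) show False by (simp add: prod_eq_iff)
qed

text \<open>Two lifted hyperedges that share a lift of \<open>p\<close> differ exactly in their own incidences with
  \<open>p\<close>.\<close>
lemma meet_lift_bit: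
  assumes "sym_diff (snd k) {(fst k, p)} = sym_diff (snd g) {(fst g, p)}" "fst g \<noteq> fst k"
  shows "((f, x) \<in> snd g \<longleftrightarrow> (f, x) \<in> snd k) \<longleftrightarrow> \<not> (x = p \<and> (f = fst k \<or> f = fst g))"
proof -
  have "(f, x) \<in> sym_diff (snd k) {(fst k, p)} \<longleftrightarrow> (f, x) \<in> sym_diff (snd g) {(fst g, p)}"
    using assms(1) by simp
  then show ?thesis using assms(2) by auto
qed

context sparse_hypergraph
begin

text \<open>A counterexample \<open>F\<close> (only the root may be a leaf) has to project injectively onto \<open>L + 1\<close>
  hyperedges, since a leaf of a smaller projection lifts to a leaf. Fix a hyperedge \<open>k\<close> of \<open>F\<close> that
  is not the root, and an incidence \<open>(k, p)\<close> where it meets others. The coordinate \<open>(k, p)\<close> splits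
  \<open>F\<close> into two classes which touch only along the point \<open>p\<close> of \<open>k\<close>. The class
  that avoids the root, with \<open>k\<close> added if it is missing, is a proper subfamily. Rooted at
  \<open>k\<close>, it has another leaf, and this one is also a leaf in \<open>F\<close>.\<close>
lemma lift_leaf_exists:
  assumes F: "F \<subseteq> E \<times> Pow (Sigma E P)" and r: "r \<in> F" and two: "2 \<le> card F" and card: "card F \<le> Suc L"
  shows "\<exists>k\<in>F - {r}. leaf (lift_points P) F k"
proof (rule ccontr)
  assume "\<not> ?thesis"
  then have bad: "\<not> leaf (lift_points P) F k" if "k \<in> F" "k \<noteq> r" for k
    using that by blast
  have finF: "finite F" using two card.infinite by fastforce
  have FE: "fst ` F \<subseteq> E" using F by auto
  obtain k where k: "k \<in> F" "k \<noteq> r"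
  proof -
    have "card (F - {r}) \<noteq> 0" using two r finF by simp
    then show thesis using that by (metis Diff_iff all_not_in_conv card.empty insertI1)
  qed
  have "\<not> card (fst ` F) \<le> L"
  proof
    assume le: "card (fst ` F) \<le> L"
    obtain p q g h where g: "g \<in> F - {k}"
      "sym_diff (snd k) {(fst k, p)} = sym_diff (snd g) {(fst g, p)}"
      using not_leaf_lift[OF bad[OF k]] by metis
    then have "fst g \<noteq> fst k" using meet_lift_distinct[OF g(2)] by auto
    then have "card {fst g, fst k} \<le> card (fst ` F)"
      using g k finF by (intro card_mono) auto
    then have "2 \<le> card (fst ` F)" using \<open>fst g \<noteq> fst k\<close> by simp
    then obtain f where f: "f \<in> fst ` F - {fst r}" "leaf P (fst ` F) f"
      using leaf_exists[OF FE _ _ le] r by blast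
    then obtain m where m: "m \<in> F" "m \<noteq> r" "fst m = f" by auto
    obtain p q g h where *: "p \<noteq> q" "p \<in> P (fst m)" "q \<in> P (fst m)"
      "g \<in> F - {m}" "p \<in> P (fst g)" "sym_diff (snd m) {(fst m, p)} = sym_diff (snd g) {(fst g, p)}"
      "h \<in> F - {m}" "q \<in> P (fst h)" "sym_diff (snd m) {(fst m, q)} = sym_diff (snd h) {(fst h, q)}"
      by (rule not_leaf_lift[OF bad[OF m(1,2)]])
    have "fst g \<noteq> fst m" "fst h \<noteq> fst m"
      using meet_lift_distinct[OF *(6)] meet_lift_distinct[OF *(9)] * by auto
    then have "p \<in> P f \<inter> (\<Union>g\<in>fst ` F - {f}. P g)" "q \<in> P f \<inter> (\<Union>g\<in>fst ` F - {f}. P g)"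
      using * m(3) by auto
    then show False using f(2) \<open>p \<noteq> q\<close> unfolding leaf_def by blast
  qed
  then have cards: "card (fst ` F) = Suc L" "card F = Suc L"
    using card card_image_le[OF finF, of fst] by auto
  then have inj: "inj_on fst F" using finF by (simp add: eq_card_imp_inj_on)
  have sub: "\<exists>m\<in>M - {c}. leaf P (fst ` M) (fst m)"
    if M: "M \<subset> F" "c \<in> M" "2 \<le> card M" for M c
  proof -
    have injM: "inj_on fst M" using inj M(1) by (meson inj_on_subset psubset_imp_subset)
    have "card M < card F" using M(1) finF by (rule psubset_card_mono[rotated])
    then have "card (fst ` M) \<le> L" "2 \<le> card (fst ` M)"
      using card_image[OF injM] M(3) cards by auto
    moreover have "fst ` M \<subseteq> E" using FE M by auto
    ultimately obtain f where "f \<in> fst ` M - {fst c}" "leaf P (fst ` M) f"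
      using leaf_exists[of "fst ` M" "fst c"] M(2) by blast
    then show ?thesis by auto
  qed
  \<comment> \<open>A proper subfamily \<open>M\<close> which meets the rest of \<open>F\<close> only through its member \<open>c\<close>, and which
    does not contain the root except possibly as \<open>c\<close>, has no member besides \<open>c\<close>.\<close>
  have no_sub: False
    if M: "M \<subset> F" "c \<in> M" "g0 \<in> M" "g0 \<noteq> c" 
    and closed: "\<And>m g p. \<lbrakk>m \<in> M; m \<noteq> c; g \<in> F - {m};
      sym_diff (snd m) {(fst m, p)} = sym_diff (snd g) {(fst g, p)}\<rbrakk> \<Longrightarrow> g \<in> M"
    and rM: "r \<notin> M - {c}" for M c g0
  proof -
    have "finite M" using M(1) finF by (meson finite_subset psubset_imp_subset)
    then have "card {g0, c} \<le> card M" using M by (intro card_mono) auto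
    then have "2 \<le> card M" using M by simp
    then obtain m where m: "m \<in> M" "m \<noteq> c" "leaf P (fst ` M) (fst m)" using sub M by blast
    have mF: "m \<in> F" "m \<noteq> r" using m M rM by auto
    obtain p q g h where *: "p \<noteq> q" "p \<in> P (fst m)" "q \<in> P (fst m)"
      "g \<in> F - {m}" "p \<in> P (fst g)" "sym_diff (snd m) {(fst m, p)} = sym_diff (snd g) {(fst g, p)}"
      "h \<in> F - {m}" "q \<in> P (fst h)" "sym_diff (snd m) {(fst m, q)} = sym_diff (snd h) {(fst h, q)}"
      by (rule not_leaf_lift[OF bad[OF mF]])
    have "g \<in> M" "h \<in> M" using closed[OF m(1,2)] * by blast+
    moreover have "fst g \<noteq> fst m" "fst h \<noteq> fst m"
      using meet_lift_distinct[OF *(6)] meet_lift_distinct[OF *(9)] * by auto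
    ultimately have "p \<in> P (fst m) \<inter> (\<Union>g\<in>fst ` M - {fst m}. P g)"
      "q \<in> P (fst m) \<inter> (\<Union>g\<in>fst ` M - {fst m}. P g)" using * by auto
    then show False using m(3) \<open>p \<noteq> q\<close> unfolding leaf_def by blast
  qed
  obtain p q g h where *: "p \<noteq> q" "p \<in> P (fst k)" "q \<in> P (fst k)"
      "g \<in> F - {k}" "p \<in> P (fst g)" "sym_diff (snd k) {(fst k, p)} = sym_diff (snd g) {(fst g, p)}"
      "h \<in> F - {k}" "q \<in> P (fst h)" "sym_diff (snd k) {(fst k, q)} = sym_diff (snd h) {(fst h, q)}"
    by (rule not_leaf_lift[OF bad[OF k]])
  \<comment> \<open>The coordinate of the fibre that can only change along the lifts of the point \<open>p\<close> in \<open>k\<close>.\<close>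
  define bit where "bit m \<longleftrightarrow> (fst k, p) \<in> snd m" for m :: "'e \<times> ('e \<times> 'v) set"
  define M where "M = {m \<in> F. bit m = bit k}"
  have gh: "fst g \<noteq> fst k" "fst h \<noteq> fst k"
    using meet_lift_distinct[OF *(6)] meet_lift_distinct[OF *(9)] * by auto
  have g_out: "g \<notin> M" and h_in: "h \<in> M"
    using meet_lift_bit[OF *(6) gh(1), of "fst k" p] meet_lift_bit[OF *(9) gh(2), of "fst k" p] *
    by (auto simp: M_def bit_def)
  have keep: "bit m' = bit m"
    if "m \<in> F" "m' \<in> F - {m}" "m \<noteq> k" "m' \<noteq> k"
      "sym_diff (snd m) {(fst m, x)} = sym_diff (snd m') {(fst m', x)}" for m m' x
  proof -
    have "fst m' \<noteq> fst m" using meet_lift_distinct[OF that(5)] that(2) by auto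
    moreover have "fst m \<noteq> fst k" "fst m' \<noteq> fst k"
      using inj that k by (auto dest: inj_onD)
    ultimately show ?thesis unfolding bit_def using meet_lift_bit[OF that(5)] by auto
  qed
  have k_out: "x = p"
    if "m \<in> F" "m \<noteq> k" "sym_diff (snd m) {(fst m, x)} = sym_diff (snd k) {(fst k, x)}"
      "bit m \<noteq> bit k" for m x
  proof -
    have "fst k \<noteq> fst m" using meet_lift_distinct[OF that(3)] that(2) by auto
    then show ?thesis using meet_lift_bit[OF that(3), of "fst k" p] that(4) unfolding bit_def by auto
  qed
  show False
  proof (cases "r \<in> M")
    case True
    show False
    proof (rule no_sub[of "insert k (F - M)" k g])
      show "insert k (F - M) \<subset> F" using k h_in * by (auto simp: M_def)
      show "r \<notin> insert k (F - M) - {k}" using True by auto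
    next
      fix m m' x assume m: "m \<in> insert k (F - M)" "m \<noteq> k" "m' \<in> F - {m}"
        "sym_diff (snd m) {(fst m, x)} = sym_diff (snd m') {(fst m', x)}"
      then show "m' \<in> insert k (F - M)" using keep[of m m' x] by (auto simp: M_def)
    qed (use g_out * in auto)
  next
    case False
    show False
    proof (rule no_sub[of M k h])
      show "M \<subset> F" using g_out * by (auto simp: M_def)
    next
      fix m m' x assume m: "m \<in> M" "m \<noteq> k" "m' \<in> F - {m}"
        "sym_diff (snd m) {(fst m, x)} = sym_diff (snd m') {(fst m', x)}"
      then show "m' \<in> M" using keep[of m m' x] k by (cases "m' = k") (auto simp: M_def)
    qed (use h_in * k False in \<open>auto simp: M_def\<close>)
  qed
qed

lemma sparse_hypergraph_lift:
  "sparse_hypergraph n d (Suc L) (E \<times> Pow (Sigma E P)) (lift_points P)"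
proof
  have "finite (Sigma E P)" using finite_E finite_P by auto
  then show "finite (E \<times> Pow (Sigma E P))" using finite_E by simp
  show "E \<times> Pow (Sigma E P) \<noteq> {}" using E_nonempty by auto
  fix k assume k: "k \<in> E \<times> Pow (Sigma E P)"
  then show "finite (lift_points P k)" using finite_P by (auto simp: lift_points_def)
  have "card (lift_points P k) = card (P (fst k))"
    unfolding lift_points_def by (rule card_image) (auto simp: inj_on_def)
  then show "card (lift_points P k) = n" using k card_P by auto
  fix x assume x: "x \<in> lift_points P k"
  then obtain p t where p: "x = (p, t)" "p \<in> P (fst k)" "t = sym_diff (snd k) {(fst k, p)}"
    by (auto simp: lift_points_def)
  have t: "t \<subseteq> Sigma E P" using p k by auto
  let ?lift = "\<lambda>g. (g, sym_diff t {(g, p)})"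
  have sub: "?lift ` {g \<in> E. p \<in> P g} \<subseteq> {g \<in> E \<times> Pow (Sigma E P). x \<in> lift_points P g}"
  proof (rule image_subsetI)
    fix g assume "g \<in> {g \<in> E. p \<in> P g}"
    then have g: "g \<in> E" "p \<in> P g" by auto
    have "(g, sym_diff t {(g, p)}) \<in> E \<times> Pow (Sigma E P)" using t g by auto
    moreover have "sym_diff (sym_diff t {(g, p)}) {(g, p)} = t" by blast
    then have "x \<in> lift_points P (g, sym_diff t {(g, p)})"
      using g p(1) unfolding lift_points_def by (intro image_eqI[of _ _ p]) auto
    ultimately show "(g, sym_diff t {(g, p)}) \<in> {g \<in> E \<times> Pow (Sigma E P). x \<in> lift_points P g}"
      by simp
  qed
  have "card (?lift ` {g \<in> E. p \<in> P g}) = card {g \<in> E. p \<in> P g}"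
    by (rule card_image) (auto simp: inj_on_def)
  moreover have fin: "finite {g \<in> E \<times> Pow (Sigma E P). x \<in> lift_points P g}"
    using \<open>finite (E \<times> Pow (Sigma E P))\<close> by simp
  ultimately have "card {g \<in> E. p \<in> P g} \<le> card {g \<in> E \<times> Pow (Sigma E P). x \<in> lift_points P g}"
    using card_mono[OF fin sub] by simp
  then show "d \<le> card {g \<in> E \<times> Pow (Sigma E P). x \<in> lift_points P g}"
    using degree[of "fst k" p] k p by auto
qed (rule lift_leaf_exists)

end

text \<open>For \<open>L = 0\<close> the leaf condition is void, so any number of hyperedges with the same points will
  do. Each lift preserves sizes and degrees and increases \<open>L\<close> by one.\<close>
theorem sparse_hypergraph_exists:
  "\<exists>(E :: nat set) (P :: nat \<Rightarrow> nat set). sparse_hypergraph n d L E P"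
proof (induction L)
  case 0
  have "sparse_hypergraph n d 0 {..<Suc d} (\<lambda>_. {..<n})"
    by unfold_locales auto
  then show ?case by blast
next
  case (Suc L)
  then obtain E :: "nat set" and P :: "nat \<Rightarrow> nat set" where "sparse_hypergraph n d L E P" by blast
  from sparse_hypergraph_on_nat[OF sparse_hypergraph.sparse_hypergraph_lift[OF this]]
  show ?case .
qed

section \<open>Connectivity by cuts, and blocks\<close>

lemma ex_maximal_set:
  assumes "finite X" "Q S" "\<And>T. Q T \<Longrightarrow> T \<subseteq> X"
  shows "\<exists>T. Q T \<and> (\<forall>T'. Q T' \<and> T \<subseteq> T' \<longrightarrow> T' = T)"
proof -
  have "finite {T. Q T}" by (rule finite_subset[of _ "Pow X"]) (use assms in auto)
  moreover have "{T. Q T} \<noteq> {}" using assms(2) by blast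
  ultimately obtain T where "T \<in> {T. Q T}" "\<forall>T'\<in>{T. Q T}. T \<subseteq> T' \<longrightarrow> T = T'"
    by (meson finite_has_maximal)
  then show ?thesis by auto
qed

lemma ex_minimal_set:
  assumes "finite X" "Q S" "\<And>T. Q T \<Longrightarrow> T \<subseteq> X"
  shows "\<exists>T. Q T \<and> (\<forall>T'. Q T' \<and> T' \<subseteq> T \<longrightarrow> T' = T)"
proof -
  have "finite {T. Q T}" by (rule finite_subset[of _ "Pow X"]) (use assms in auto)
  moreover have "{T. Q T} \<noteq> {}" using assms(2) by blast
  ultimately obtain T where "T \<in> {T. Q T}" "\<forall>T'\<in>{T. Q T}. T' \<subseteq> T \<longrightarrow> T = T'"
    by (meson finite_has_minimal)
  then show ?thesis by auto
qed

text \<open>Connectedness of a vertex set in the form in which it is used and proved here: each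
  cut is crossed by an edge.\<close>
definition conn :: "'a ugraph \<Rightarrow> 'a set \<Rightarrow> bool" where
  "conn G S \<longleftrightarrow> S \<noteq> {} \<and>
     (\<forall>A. A \<subseteq> S \<and> A \<noteq> {} \<and> A \<noteq> S \<longrightarrow> (\<exists>a\<in>A. \<exists>b\<in>S - A. {a, b} \<in> edges G))"

lemma connD:
  assumes "conn G S" "A \<subseteq> S" "a \<in> A" "b \<in> S" "b \<notin> A"
  obtains a' b' where "a' \<in> A" "b' \<in> S - A" "{a', b'} \<in> edges G"
  using assms unfolding conn_def by blast

lemma conn_singleton: "conn G {v}"
  unfolding conn_def by blast

lemma connected_graph_induced: "connected_graph (induced G S) \<longleftrightarrow> conn G S"
proof
  let ?R = "{(x, y). {x, y} \<in> edges (induced G S)}"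
  show "conn G S" if con: "connected_graph (induced G S)"
    unfolding conn_def
  proof (intro conjI allI impI)
    show "S \<noteq> {}" using con by (simp add: connected_graph_def induced_def)
    fix A assume "A \<subseteq> S \<and> A \<noteq> {} \<and> A \<noteq> S"
    then obtain u v where A: "A \<subseteq> S" "u \<in> A" and v: "v \<in> S" "v \<notin> A" by blast
    have "(u, v) \<in> ?R\<^sup>*"
      using con A v by (auto simp: connected_graph_def induced_def)
    moreover have "w \<in> A" if "(u, w) \<in> ?R\<^sup>*" "\<not> (\<exists>a\<in>A. \<exists>b\<in>S - A. {a, b} \<in> edges G)" for w
      using that(1)
    proof induction
      case base show ?case using A by simp
    next
      case (step y z) then show ?case using that(2) by (auto simp: induced_def)
    qed
    ultimately show "\<exists>a\<in>A. \<exists>b\<in>S - A. {a, b} \<in> edges G" using v by blast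
  qed
  show "connected_graph (induced G S)" if con: "conn G S"
    unfolding connected_graph_def
  proof safe
    show False if "verts (induced G S) = {}" using con that by (simp add: conn_def induced_def)
    fix u v assume uv: "u \<in> verts (induced G S)" "v \<in> verts (induced G S)"
    define A where "A = {w \<in> S. (u, w) \<in> ?R\<^sup>*}"
    have "v \<in> A"
    proof (rule ccontr)
      assume "v \<notin> A"
      moreover have "A \<subseteq> S" "u \<in> A" "v \<in> S" using uv by (auto simp: A_def induced_def)
      ultimately obtain a b where ab: "a \<in> A" "b \<in> S - A" "{a, b} \<in> edges G"
        using connD[OF con] by metis
      then have "(a, b) \<in> ?R" by (auto simp: A_def induced_def)
      then have "b \<in> A" using ab by (auto simp: A_def intro: rtrancl_into_rtrancl)
      then show False using ab by blast
    qed
    then show "(u, v) \<in> ?R\<^sup>*" by (simp add: A_def)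
  qed
qed

lemma conn_union_edge:
  assumes "conn G S" "conn G T" "s \<in> S" "t \<in> T" "{s, t} \<in> edges G"
  shows "conn G (S \<union> T)"
  unfolding conn_def
proof (intro conjI allI impI)
  show "S \<union> T \<noteq> {}" using assms by blast
  fix A assume A: "A \<subseteq> S \<union> T \<and> A \<noteq> {} \<and> A \<noteq> S \<union> T"
  have ts: "{t, s} \<in> edges G" using assms(5) by (simp add: insert_commute)
  show "\<exists>a\<in>A. \<exists>b\<in>S \<union> T - A. {a, b} \<in> edges G"
  proof (cases "A \<inter> S \<noteq> {} \<and> A \<inter> S \<noteq> S \<or> A \<inter> T \<noteq> {} \<and> A \<inter> T \<noteq> T")
    case True
    then show ?thesis
    proof
      assume "A \<inter> S \<noteq> {} \<and> A \<inter> S \<noteq> S"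
      then have "\<exists>a\<in>A \<inter> S. \<exists>b\<in>S - A \<inter> S. {a, b} \<in> edges G"
        using assms(1) unfolding conn_def by auto
      then show ?thesis by blast
    next
      assume "A \<inter> T \<noteq> {} \<and> A \<inter> T \<noteq> T"
      then have "\<exists>a\<in>A \<inter> T. \<exists>b\<in>T - A \<inter> T. {a, b} \<in> edges G"
        using assms(2) unfolding conn_def by auto
      then show ?thesis by blast
    qed
  next
    case False
    then have "s \<in> A \<and> t \<notin> A \<or> t \<in> A \<and> s \<notin> A" using A assms(3,4) by blast
    then show ?thesis using assms(3-5) ts by blast
  qed
qed

lemma conn_insert:
  assumes "conn G S" "s \<in> S" "{s, t} \<in> edges G"
  shows "conn G (insert t S)"
  using conn_union_edge[OF assms(1) conn_singleton assms(2) _ assms(3)] by simp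

definition biconn :: "'a ugraph \<Rightarrow> 'a set \<Rightarrow> bool" where
  "biconn G S \<longleftrightarrow> finite S \<and> 2 \<le> card S \<and> conn G S \<and> (\<forall>v\<in>S. conn G (S - {v}))"

text \<open>With at least two vertices, the two clauses of 2-connectedness merge: a single edge is connected
  and so are its two vertex-deleted subgraphs.\<close>
lemma two_connected_induced:
  assumes "2 \<le> card S"
  shows "two_connected (induced G S) \<longleftrightarrow> biconn G S"
proof -
  have "induced (induced G S) (verts (induced G S) - {v}) = induced G (S - {v})" for v
    by (auto simp: induced_def)
  then have ind: "connected_graph (induced (induced G S) (verts (induced G S) - {v})) \<longleftrightarrow>
      conn G (S - {v})" for v
    by (simp only: connected_graph_induced)
  have vs: "verts (induced G S) = S" by (simp add: induced_def)
  have fin: "finite S" using assms card.infinite by fastforce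
  show ?thesis
  proof (cases "card S = 2")
    case True
    then obtain u v where uv: "S = {u, v}" "u \<noteq> v" by (meson card_2_iff)
    have "complete_graph (induced G S) \<longleftrightarrow> {u, v} \<in> edges G"
      using uv by (auto simp: complete_graph_def induced_def insert_commute)
    moreover have "conn G S \<longleftrightarrow> {u, v} \<in> edges G"
    proof
      assume "conn G S"
      then obtain a b where "a \<in> {u}" "b \<in> S - {u}" "{a, b} \<in> edges G"
        by (rule connD[of G S "{u}" u v]) (use uv in auto)
      then show "{u, v} \<in> edges G" using uv by auto
    qed (use uv conn_insert[OF conn_singleton[of G u], of u v] in \<open>simp add: insert_commute\<close>)
    moreover have "conn G (S - {w})" if "w \<in> S" for w
    proof -
      have "S - {w} = {u} \<or> S - {w} = {v}" using that uv by auto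
      then show ?thesis using conn_singleton by metis
    qed
    ultimately show ?thesis using True fin by (auto simp: two_connected_def biconn_def vs)
  next
    case False
    then show ?thesis using assms fin unfolding two_connected_def biconn_def ind
      by (auto simp: vs connected_graph_induced)
  qed
qed

definition max_biconn :: "'a ugraph \<Rightarrow> 'a set \<Rightarrow> bool" where
  "max_biconn G S \<longleftrightarrow> S \<subseteq> verts G \<and> biconn G S \<and> (\<forall>T. S \<subset> T \<and> T \<subseteq> verts G \<longrightarrow> \<not> biconn G T)"

lemma max_biconn_block:
  assumes "simple_graph G" "2 \<le> card S"
  shows "max_biconn G S \<longleftrightarrow> induced G S \<in> blocks G"
proof -
  have fin: "finite (verts G)" using assms(1) by (simp add: simple_graph_def)
  have eq: "induced G S = induced G S' \<longleftrightarrow> S = S'" for S' by (auto simp: induced_def)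
  have "2 \<le> card T" if "S \<subset> T" "T \<subseteq> verts G" for T
    using assms(2) card_mono[of T S] that fin by (meson finite_subset le_trans psubset_imp_subset)
  then show ?thesis
    unfolding max_biconn_def blocks_def using two_connected_induced[of _ G] assms(2) eq by auto
qed

lemma edge_in_max_biconn:
  assumes G: "simple_graph G" and e: "{u, v} \<in> edges G"
  obtains T where "u \<in> T" "v \<in> T" "max_biconn G T"
proof -
  have uv: "u \<noteq> v" "{u, v} \<subseteq> verts G" using G e unfolding simple_graph_def by (metis doubleton_eq_iff insert_subset empty_subsetI)+
  let ?Q = "\<lambda>T. {u, v} \<subseteq> T \<and> T \<subseteq> verts G \<and> biconn G T"
  have "complete_graph (induced G {u, v})" using e by (auto simp: complete_graph_def induced_def insert_commute)
  then have "two_connected (induced G {u, v})"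
    using uv by (simp add: two_connected_def induced_def)
  then have start: "?Q {u, v}" using uv two_connected_induced[of "{u, v}" G] by simp
  have "finite (verts G)" using G by (simp add: simple_graph_def)
  then have "\<exists>T. ?Q T \<and> (\<forall>T'. ?Q T' \<and> T \<subseteq> T' \<longrightarrow> T' = T)"
    by (rule ex_maximal_set[of "verts G" ?Q "{u, v}"]) (use start in auto)
  then obtain T where T: "?Q T \<and> (\<forall>T'. ?Q T' \<and> T \<subseteq> T' \<longrightarrow> T' = T)" ..
  have "\<not> biconn G T'" if "T \<subset> T'" "T' \<subseteq> verts G" for T'
  proof
    assume "biconn G T'"
    then have "T' = T" using T that by (meson order_trans psubset_imp_subset)
    then show False using that(1) by simp
  qed
  then have "max_biconn G T" using T by (simp add: max_biconn_def)
  then show thesis using that[of T] T by simp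
qed

text \<open>The rest of \<open>G\<close> hangs off \<open>U\<close> at single vertices: no path through the outside links two
  vertices of \<open>U\<close>. This is the invariant which allows a graph to be
  built up block by block without ever mentioning its block tree.\<close>
definition tree_closed :: "'a ugraph \<Rightarrow> 'a set \<Rightarrow> bool" where
  "tree_closed G U \<longleftrightarrow> (\<forall>C c c' p q. conn G C \<and> C \<subseteq> verts G - U \<and> c \<in> C \<and> c' \<in> C \<and> p \<in> U \<and> q \<in> U \<and>
      {c, p} \<in> edges G \<and> {c', q} \<in> edges G \<longrightarrow> p = q)"

lemma tree_closedD:
  assumes "tree_closed G U" "conn G C" "C \<subseteq> verts G - U" "c \<in> C" "c' \<in> C" "p \<in> U" "q \<in> U"
    "{c, p} \<in> edges G" "{c', q} \<in> edges G"
  shows "p = q"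
  using assms unfolding tree_closed_def by blast

text \<open>An ear argument with an inclusion-minimal connected set \<open>D\<close> adjacent to both \<open>p\<close> and \<open>q\<close> in the
  place of a path. If removing a vertex \<open>x\<close> of \<open>D\<close> cut a part \<open>K\<close> of \<open>D\<close> off from \<open>S\<close>, then \<open>D - K\<close>
  would be a smaller such set.\<close>
lemma biconn_ear:
  assumes S: "biconn G S" and C: "conn G C" "finite C" "C \<inter> S = {}"
    and c: "c \<in> C" "c' \<in> C" "p \<in> S" "q \<in> S" "p \<noteq> q" "{c, p} \<in> edges G" "{c', q} \<in> edges G"
  shows "\<exists>D\<subseteq>C. D \<noteq> {} \<and> biconn G (S \<union> D)"
proof -
  let ?Q = "\<lambda>D. D \<subseteq> C \<and> conn G D \<and> (\<exists>c\<in>D. {c, p} \<in> edges G) \<and> (\<exists>c\<in>D. {c, q} \<in> edges G)"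
  have "?Q C" using C c by blast
  then have "\<exists>D. ?Q D \<and> (\<forall>D'. ?Q D' \<and> D' \<subseteq> D \<longrightarrow> D' = D)"
    by (intro ex_minimal_set[of C ?Q C, OF C(2)]) auto
  then obtain D where "?Q D \<and> (\<forall>D'. ?Q D' \<and> D' \<subseteq> D \<longrightarrow> D' = D)" ..
  then have D: "?Q D" and min: "\<And>D'. ?Q D' \<Longrightarrow> D' \<subseteq> D \<Longrightarrow> D' = D" by auto
  obtain a b where ab: "a \<in> D" "b \<in> D" "{a, p} \<in> edges G" "{b, q} \<in> edges G" using D by blast
  have finD: "finite D" using D C(2) finite_subset by blast
  have disj: "D \<inter> S = {}" using D C(3) by blast
  have finS: "finite S" and cS: "conn G S" and cSx: "\<And>x. x \<in> S \<Longrightarrow> conn G (S - {x})"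
    using S by (auto simp: biconn_def)
  have all: "conn G (D \<union> S)" using conn_union_edge[OF _ cS ab(1) c(3) ab(3)] D by blast
  have Dx: "conn G (D \<union> S - {x})" if x: "x \<in> D" for x
    unfolding conn_def
  proof (intro conjI allI impI)
    show "D \<union> S - {x} \<noteq> {}" using c disj x by blast
    fix A assume A: "A \<subseteq> D \<union> S - {x} \<and> A \<noteq> {} \<and> A \<noteq> D \<union> S - {x}"
    have key: False if K: "K \<subseteq> D - {x}" "K \<noteq> {}"
      and no: "\<And>k y. k \<in> K \<Longrightarrow> y \<in> D \<union> S - {x} - K \<Longrightarrow> {k, y} \<notin> edges G" for K
    proof -
      have "a \<notin> K" "b \<notin> K" using no[of a p] no[of b q] ab c disj D K x by auto
      moreover have "conn G (D - K)"
        unfolding conn_def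
      proof (intro conjI allI impI)
        show "D - K \<noteq> {}" using x K by blast
        fix A' assume A': "A' \<subseteq> D - K \<and> A' \<noteq> {} \<and> A' \<noteq> D - K"
        show "\<exists>a\<in>A'. \<exists>b\<in>D - K - A'. {a, b} \<in> edges G"
        proof (cases "x \<in> A'")
          case False
          obtain y z where yz: "y \<in> A'" "z \<in> D - A'" "{y, z} \<in> edges G"
            by (rule connD[of G D A' "SOME y. y \<in> A'" x])
               (use D A' x False some_in_eq in auto)
          have "z \<notin> K" using no[of z y] yz A' False by (auto simp: insert_commute)
          then show ?thesis using yz by blast
        next
          case True
          then obtain t where t: "t \<in> D - K - A'" using A' by blast
          obtain y z where yz: "y \<in> D - K - A'" "z \<in> D - (D - K - A')" "{y, z} \<in> edges G"
            by (rule connD[of G D "D - K - A'" t x]) (use D True t x in auto)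
          have "z \<notin> K" using no[of z y] yz True by (auto simp: insert_commute)
          then have "z \<in> A'" using yz by blast
          then show ?thesis using yz by (metis insert_commute)
        qed
      qed
      ultimately have "?Q (D - K)" using D ab by blast
      then show False using min K by blast
    qed
    show "\<exists>a\<in>A. \<exists>b\<in>D \<union> S - {x} - A. {a, b} \<in> edges G"
    proof (rule ccontr)
      assume no: "\<not> ?thesis"
      have "A \<inter> S = {} \<or> A \<inter> S = S"
      proof (rule ccontr)
        assume "\<not> ?thesis"
        then obtain y z where "y \<in> A \<inter> S" "z \<in> S - A \<inter> S" "{y, z} \<in> edges G"
          using cS unfolding conn_def by (metis inf_le2)
        then show False using no disj x by blast
      qed
      then show False
      proof
        assume "A \<inter> S = {}"
        then have "A \<subseteq> D - {x}" "A \<noteq> {}" using A by blast+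
        then show False by (rule key) (use no in blast)
      next
        assume "A \<inter> S = S"
        then have "D \<union> S - {x} - A \<subseteq> D - {x}" "D \<union> S - {x} - A \<noteq> {}" using A by blast+
        then show False
        proof (rule key)
          fix k y assume "k \<in> D \<union> S - {x} - A" "y \<in> D \<union> S - {x} - (D \<union> S - {x} - A)"
          then show "{k, y} \<notin> edges G" using no insert_commute[of k y "{}"] by auto
        qed
      qed
    qed
  qed
  have Sx: "conn G (D \<union> S - {x})" if x: "x \<in> S" for x
  proof -
    have eq: "D \<union> S - {x} = D \<union> (S - {x})" using disj x by blast
    show ?thesis
    proof (cases "p = x")
      case True
      then show ?thesis unfolding eq using conn_union_edge[OF _ cSx[OF x] ab(2) _ ab(4)] D c by auto
    next
      case False
      then show ?thesis unfolding eq using conn_union_edge[OF _ cSx[OF x] ab(1) _ ab(3)] D c by auto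
    qed
  qed
  have "2 \<le> card (D \<union> S)"
    using S card_mono[of "D \<union> S" S] finD finS by (auto simp: biconn_def)
  then have "biconn G (S \<union> D)"
    using all Dx Sx finD finS unfolding biconn_def by (auto simp: Un_commute)
  then show ?thesis using D ab by blast
qed

lemma max_biconn_tree_closed:
  assumes G: "simple_graph G" and S: "max_biconn G S"
  shows "tree_closed G S"
  unfolding tree_closed_def
proof (intro allI impI, elim conjE, rule ccontr)
  fix C c c' p q
  assume *: "conn G C" "C \<subseteq> verts G - S" "c \<in> C" "c' \<in> C" "p \<in> S" "q \<in> S"
    "{c, p} \<in> edges G" "{c', q} \<in> edges G" "p \<noteq> q"
  have "finite C" using G *(2) by (auto simp: simple_graph_def intro: finite_subset)
  then obtain D where D: "D \<subseteq> C" "D \<noteq> {}" "biconn G (S \<union> D)"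
    using biconn_ear[of G S C c c' p q] S * unfolding max_biconn_def by blast
  then have "S \<subset> S \<union> D" "S \<union> D \<subseteq> verts G" using * S unfolding max_biconn_def by blast+
  then show False using D S unfolding max_biconn_def by blast
qed

lemma maximal_conn_within:
  assumes "finite X" "w \<in> X"
  obtains C where "w \<in> C" "C \<subseteq> X" "conn G C" "\<And>c y. c \<in> C \<Longrightarrow> y \<in> X - C \<Longrightarrow> {c, y} \<notin> edges G"
proof -
  let ?Q = "\<lambda>C. w \<in> C \<and> C \<subseteq> X \<and> conn G C"
  have "?Q {w}" using assms conn_singleton[of G w] by auto
  then have "\<exists>C. ?Q C \<and> (\<forall>C'. ?Q C' \<and> C \<subseteq> C' \<longrightarrow> C' = C)"
    by (intro ex_maximal_set[of X ?Q "{w}", OF assms(1)]) auto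
  then obtain C where "?Q C \<and> (\<forall>C'. ?Q C' \<and> C \<subseteq> C' \<longrightarrow> C' = C)" ..
  then have C: "?Q C" and max: "\<And>C'. ?Q C' \<Longrightarrow> C \<subseteq> C' \<Longrightarrow> C' = C" by auto
  have "{c, y} \<notin> edges G" if "c \<in> C" "y \<in> X - C" for c y
  proof
    assume "{c, y} \<in> edges G"
    then have "?Q (insert y C)" using conn_insert[of G C c y] C that by blast
    then show False using max[of "insert y C"] that by blast
  qed
  then show thesis using that C by blast
qed

text \<open>Otherwise a component \<open>C\<close> of \<open>T - U\<close> would have two neighbours in \<open>U\<close>: it has one,
  \<open>b\<close>, different from \<open>v\<close>, as \<open>T - {v}\<close> is connected, and another one as \<open>T - {b}\<close> is connected.\<close>
lemma tree_closed_meets_biconn: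
  assumes U: "tree_closed G U" and T: "biconn G T" "T \<subseteq> verts G"
    and v: "v \<in> T" "v \<in> U" and w: "w \<in> T" "w \<notin> U"
  shows "T \<inter> U = {v}"
proof (rule ccontr)
  assume "T \<inter> U \<noteq> {v}"
  then obtain q where q: "q \<in> T" "q \<in> U" "q \<noteq> v" using v by blast
  have fin: "finite T" using T by (simp add: biconn_def)
  obtain C where C: "w \<in> C" "C \<subseteq> T - U" "conn G C"
    "\<And>c y. c \<in> C \<Longrightarrow> y \<in> T - U - C \<Longrightarrow> {c, y} \<notin> edges G"
    by (rule maximal_conn_within[of "T - U" w G]) (use fin w in auto)
  have nb: "\<exists>c\<in>C. \<exists>b\<in>T \<inter> U - {z}. {c, b} \<in> edges G" if zy: "z \<in> T \<inter> U" "y \<in> T \<inter> U - {z}" for z y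
  proof -
    have "conn G (T - {z})" using T zy by (simp add: biconn_def)
    then obtain c b where "c \<in> C" "b \<in> T - {z} - C" "{c, b} \<in> edges G"
      by (rule connD[of G _ C w y]) (use C zy in auto)
    then show ?thesis using C(4)[of c b] by blast
  qed
  obtain c b where cb: "c \<in> C" "b \<in> T \<inter> U - {v}" "{c, b} \<in> edges G" using nb[of v q] v q by blast
  obtain c' b' where cb': "c' \<in> C" "b' \<in> T \<inter> U - {b}" "{c', b'} \<in> edges G" using nb[of b v] v cb by blast
  have "b = b'"
    by (rule tree_closedD[OF U C(3), of c c']) (use C T cb cb' in auto)
  then show False using cb' by blast
qed

lemma no_edge_off_cut_vertex:
  assumes U: "tree_closed G U" and T: "biconn G T" "T \<subseteq> verts G" "T \<inter> U = {v}"
    and tu: "t \<in> T - {v}" "u \<in> U - {v}"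
  shows "{t, u} \<notin> edges G"
proof
  assume e: "{t, u} \<in> edges G"
  have v: "v \<in> T" "v \<in> U" using T by auto
  have "conn G T" "conn G (T - {v})" using T v by (auto simp: biconn_def)
  from this(1) obtain a b where ab: "a \<in> {v}" "b \<in> T - {v}" "{a, b} \<in> edges G"
    by (rule connD[of G T "{v}" v t]) (use tu v in auto)
  have "v = u"
    by (rule tree_closedD[OF U \<open>conn G (T - {v})\<close>, of b t])
       (use ab tu T v e in \<open>auto simp: insert_commute\<close>)
  then show False using tu by blast
qed

text \<open>A connected set \<open>C\<close> outside with a neighbour in \<open>U - T\<close> and one in \<open>T - U\<close> would make
  \<open>C \<union> (T - {v})\<close> a connected set outside \<open>U\<close> with two neighbours in \<open>U\<close>, the second being \<open>v\<close>. The
  other cases are covered by the closedness of \<open>U\<close> and of \<open>T\<close>.\<close>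
lemma tree_closed_add_block:
  assumes G: "simple_graph G" and U: "tree_closed G U" and T: "max_biconn G T" "T \<inter> U = {v}"
  shows "tree_closed G (U \<union> T)"
  unfolding tree_closed_def
proof (intro allI impI, elim conjE)
  fix C c c' p q
  assume *: "conn G C" "C \<subseteq> verts G - (U \<union> T)" "c \<in> C" "c' \<in> C" "p \<in> U \<union> T" "q \<in> U \<union> T"
    "{c, p} \<in> edges G" "{c', q} \<in> edges G"
  have bi: "biconn G T" "T \<subseteq> verts G" using T by (auto simp: max_biconn_def)
  have mixed: False if m: "c \<in> C" "c' \<in> C" "p \<in> U - T" "q \<in> T - U" "{c, p} \<in> edges G" "{c', q} \<in> edges G" for c c' p q
  proof -
    have v: "v \<in> T" "v \<in> U" using T by auto
    have cT: "conn G T" "conn G (T - {v})" using bi v by (auto simp: biconn_def)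
    from this(1) obtain a b where ab: "a \<in> {v}" "b \<in> T - {v}" "{a, b} \<in> edges G"
      by (rule connD[of G T "{v}" v q]) (use m v in auto)
    have "conn G (C \<union> (T - {v}))"
      by (rule conn_union_edge[OF *(1) cT(2) m(2) _ m(6)]) (use m v in auto)
    then have "p = v"
      by (rule tree_closedD[OF U, of _ c b]) (use ab m bi T v * in \<open>auto simp: insert_commute\<close>)
    then show False using m v by blast
  qed
  show "p = q"
  proof (cases "p \<in> U \<and> q \<in> U")
    case True
    then show ?thesis using tree_closedD[OF U *(1) _ *(3,4) _ _ *(7,8)] *(2) by blast
  next
    case nU: False
    show ?thesis
    proof (cases "p \<in> T \<and> q \<in> T")
      case True
      then show ?thesis
        using tree_closedD[OF max_biconn_tree_closed[OF G T(1)] *(1) _ *(3,4) _ _ *(7,8)] *(2) by blast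
    next
      case False
      then show ?thesis using nU * mixed[of c c' p q] mixed[of c' c q p] by blast
    qed
  qed
qed

text \<open>Used when \<open>U\<close> is a union of components, to begin a new component at \<open>v\<close>.\<close>
lemma tree_closed_add_vertex:
  assumes "\<And>u w. u \<in> U \<Longrightarrow> w \<in> verts G - U \<Longrightarrow> {w, u} \<notin> edges G"
  shows "tree_closed G (insert v U)"
  unfolding tree_closed_def using assms by blast

section \<open>Induced embeddings\<close>

definition ind_emb :: "('a \<Rightarrow> 'b) \<Rightarrow> 'a ugraph \<Rightarrow> 'b ugraph \<Rightarrow> bool" where
  "ind_emb \<psi> F G \<longleftrightarrow> inj_on \<psi> (verts F) \<and> \<psi> ` verts F \<subseteq> verts G \<and>
     (\<forall>u\<in>verts F. \<forall>v\<in>verts F. {u, v} \<in> edges F \<longleftrightarrow> {\<psi> u, \<psi> v} \<in> edges G)"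

lemma not_induced_free_iff: "\<not> induced_free F G \<longleftrightarrow> (\<exists>\<psi>. ind_emb \<psi> F G)"
proof
  assume "\<not> induced_free F G"
  then obtain S \<psi> where *: "S \<subseteq> verts G" "graph_isomorphism \<psi> F (induced G S)"
    by (auto simp: induced_free_def)
  then have im: "\<psi> ` verts F = S" "inj_on \<psi> (verts F)"
    by (auto simp: graph_isomorphism_def bij_betw_def induced_def)
  then have "ind_emb \<psi> F G" using * by (auto simp: ind_emb_def graph_isomorphism_def induced_def)
  then show "\<exists>\<psi>. ind_emb \<psi> F G" by blast
next
  assume "\<exists>\<psi>. ind_emb \<psi> F G"
  then obtain \<psi> where "ind_emb \<psi> F G" by blast
  then have "\<psi> ` verts F \<subseteq> verts G" "graph_isomorphism \<psi> F (induced G (\<psi> ` verts F))"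
    by (auto simp: ind_emb_def graph_isomorphism_def induced_def bij_betw_def)
  then show "\<not> induced_free F G" unfolding induced_free_def by blast
qed

lemma omnipresent_ind_emb:
  assumes "omnipresent F G" "u \<in> verts F" "v \<in> verts G"
  obtains \<psi> where "ind_emb \<psi> F G" "\<psi> u = v"
proof -
  obtain \<psi> where "inj_on \<psi> (verts F)" "\<psi> ` verts F \<subseteq> verts G" "\<psi> u = v"
    "graph_isomorphism \<psi> F (induced G (\<psi> ` verts F))"
    using assms unfolding omnipresent_def by blast
  then have "ind_emb \<psi> F G" by (auto simp: ind_emb_def graph_isomorphism_def induced_def)
  then show thesis using that \<open>\<psi> u = v\<close> by blast
qed

lemma ind_emb_induced:
  "ind_emb \<psi> (induced F S) G \<longleftrightarrow> inj_on \<psi> S \<and> \<psi> ` S \<subseteq> verts G \<and>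
     (\<forall>u\<in>S. \<forall>v\<in>S. {u, v} \<in> edges F \<longleftrightarrow> {\<psi> u, \<psi> v} \<in> edges G)"
  by (auto simp: ind_emb_def induced_def)

lemma conn_ind_emb:
  assumes "ind_emb \<psi> (induced F S) G" "A \<subseteq> S" "conn F A"
  shows "conn G (\<psi> ` A)"
  unfolding conn_def
proof (intro conjI allI impI)
  show "\<psi> ` A \<noteq> {}" using assms by (simp add: conn_def)
  fix X assume X: "X \<subseteq> \<psi> ` A \<and> X \<noteq> {} \<and> X \<noteq> \<psi> ` A"
  then obtain s t where st: "s \<in> A" "\<psi> s \<in> X" "t \<in> A" "\<psi> t \<notin> X" by blast
  obtain a b where ab: "a \<in> {a\<in>A. \<psi> a \<in> X}" "b \<in> A - {a\<in>A. \<psi> a \<in> X}" "{a, b} \<in> edges F"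
    by (rule connD[OF assms(3), of "{a\<in>A. \<psi> a \<in> X}" s t]) (use st in auto)
  then have "{\<psi> a, \<psi> b} \<in> edges G" using assms(1,2) unfolding ind_emb_induced by blast
  then show "\<exists>a\<in>X. \<exists>b\<in>\<psi> ` A - X. {a, b} \<in> edges G" using ab by blast
qed

lemma biconn_ind_emb:
  assumes e: "ind_emb \<psi> (induced F S) G" and S: "biconn F S"
  shows "biconn G (\<psi> ` S)" "card (\<psi> ` S) = card S"
proof -
  have inj: "inj_on \<psi> S" using e by (simp add: ind_emb_induced)
  then show c: "card (\<psi> ` S) = card S" by (rule card_image)
  have "conn G (\<psi> ` S - {\<psi> v})" if "v \<in> S" for v
  proof -
    have "\<psi> ` S - {\<psi> v} = \<psi> ` (S - {v})" using inj that by (auto simp: inj_on_def)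
    then show ?thesis using conn_ind_emb[OF e, of "S - {v}"] S that by (auto simp: biconn_def)
  qed
  then show "biconn G (\<psi> ` S)"
    using S c conn_ind_emb[OF e, of S] by (auto simp: biconn_def)
qed

section \<open>Gluing copies of a graph along a hypergraph\<close>

text \<open>Each hyperedge receives a copy of \<open>W\<close>. The bijections may be arbitrary, as omnipresence
  serves whichever vertex of \<open>W\<close> is placed at a common point.
  With \<open>L \<ge> 2\<close> two hyperedges share at most one point, so the copies do not interfere.\<close>
locale glued_copies = sparse_hypergraph n d L E P
  for n d L :: nat and E :: "'e set" and P :: "'e \<Rightarrow> 'v set" +
  fixes W :: "'w ugraph" and x :: "'e \<Rightarrow> 'w \<Rightarrow> 'v"
  assumes W: "simple_graph W" and W_edge: "edges W \<noteq> {}" and L2: "2 \<le> L"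
    and x: "f \<in> E \<Longrightarrow> bij_betw (x f) (verts W) (P f)"
begin

definition glue :: "'v ugraph" where
  "glue = \<lparr>verts = (\<Union>f\<in>E. P f), edges = {x f ` e | f e. f \<in> E \<and> e \<in> edges W}\<rparr>"

lemma W_edgeE:
  assumes "e \<in> edges W"
  obtains u v where "u \<noteq> v" "u \<in> verts W" "v \<in> verts W" "e = {u, v}"
  using W assms unfolding simple_graph_def by blast

lemma x_inj: "f \<in> E \<Longrightarrow> inj_on (x f) (verts W)"
  and x_image: "f \<in> E \<Longrightarrow> x f ` verts W = P f"
  using x by (auto simp: bij_betw_def)

lemma n_ge_2: "2 \<le> n"
proof -
  obtain f where f: "f \<in> E" using E_nonempty by blast
  obtain e where "e \<in> edges W" using W_edge by blast
  then obtain u v where "u \<noteq> v" "u \<in> verts W" "v \<in> verts W" by (rule W_edgeE)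
  then have "card {u, v} \<le> card (verts W)" using W by (intro card_mono) (auto simp: simple_graph_def)
  then show ?thesis using \<open>u \<noteq> v\<close> card_P[OF f] bij_betw_same_card[OF x[OF f]] by simp
qed

lemma linear:
  assumes "f \<in> E" "g \<in> E" "f \<noteq> g" "p \<in> P f \<inter> P g" "q \<in> P f \<inter> P g"
  shows "p = q"
proof -
  obtain h where h: "h \<in> {f, g} - {f}" "leaf P {f, g} h"
    using leaf_exists[of "{f, g}" f] assms L2 by auto
  then have "h = g" "{f, g} - {g} = {f}" using assms(3) by auto
  then show ?thesis using h(2) assms unfolding leaf_def by auto
qed

lemma glue_edgeE:
  assumes "e \<in> edges glue"
  obtains f u v where "f \<in> E" "u \<in> verts W" "v \<in> verts W" "u \<noteq> v" "{u, v} \<in> edges W"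
    "e = {x f u, x f v}" "x f u \<noteq> x f v" "x f u \<in> P f" "x f v \<in> P f"
proof -
  obtain f e0 where f: "f \<in> E" "e0 \<in> edges W" "e = x f ` e0" using assms by (auto simp: glue_def)
  then obtain u v where uv: "u \<noteq> v" "u \<in> verts W" "v \<in> verts W" "e0 = {u, v}" by (meson W_edgeE)
  have "x f u \<noteq> x f v" using x_inj[OF f(1)] uv by (meson inj_onD)
  moreover have "x f u \<in> P f" "x f v \<in> P f" using x_image[OF f(1)] uv by auto
  ultimately show thesis using that f uv by auto
qed

lemma glue_edge_in_part:
  assumes "{a, b} \<in> edges glue"
  obtains f where "f \<in> E" "a \<in> P f" "b \<in> P f" "a \<noteq> b"
proof -
  obtain f u v where "f \<in> E" "{a, b} = {x f u, x f v}" "x f u \<noteq> x f v" "x f u \<in> P f" "x f v \<in> P f"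
    using glue_edgeE[OF assms] by metis
  then show thesis using that[of f] by (auto simp: doubleton_eq_iff)
qed

lemma glue_edge_iff:
  assumes f: "f \<in> E" and uv: "u \<in> verts W" "v \<in> verts W"
  shows "{x f u, x f v} \<in> edges glue \<longleftrightarrow> {u, v} \<in> edges W"
proof
  assume "{u, v} \<in> edges W"
  then show "{x f u, x f v} \<in> edges glue" using f unfolding glue_def
    by (auto intro!: exI[of _ f] exI[of _ "{u, v}"])
next
  assume "{x f u, x f v} \<in> edges glue"
  then obtain g s t where g: "g \<in> E" "s \<in> verts W" "t \<in> verts W" "{s, t} \<in> edges W"
    "{x f u, x f v} = {x g s, x g t}" "x g s \<noteq> x g t" "x g s \<in> P g" "x g t \<in> P g"
    using glue_edgeE by metis
  have "{x f u, x f v} \<subseteq> P f" using x_image[OF f] uv by auto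
  then have "{x g s, x g t} \<subseteq> P f" using g(5) by simp
  then have "f = g" using linear[OF f g(1), of "x g s" "x g t"] g by auto
  then have "x f ` {u, v} = x f ` {s, t}" using g by simp
  then have "{u, v} = {s, t}"
    using inj_on_image_eq_iff[OF x_inj[OF f], of "{u, v}" "{s, t}"] uv g by simp
  then show "{u, v} \<in> edges W" using g by simp
qed

lemma simple_glue: "simple_graph glue"
  unfolding simple_graph_def
proof (intro conjI ballI)
  show "finite (verts glue)" using finite_E finite_P by (auto simp: glue_def)
  fix e assume "e \<in> edges glue"
  then show "\<exists>u\<in>verts glue. \<exists>v\<in>verts glue. u \<noteq> v \<and> e = {u, v}"
  proof (rule glue_edgeE)
    fix f u v assume "f \<in> E" "e = {x f u, x f v}" "x f u \<noteq> x f v" "x f u \<in> P f" "x f v \<in> P f"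
    then show ?thesis by (auto simp: glue_def)
  qed
qed

lemma glue_nonempty: "edges glue \<noteq> {}"
  using E_nonempty W_edge unfolding glue_def by auto

text \<open>Choose a minimal set \<open>F\<close> of hyperedges covering the edges of \<open>glue\<close> inside \<open>S\<close>. If it had two
  members, it would have a leaf \<open>f\<close>, and the at most one point shared by \<open>f\<close> and the others would
  separate \<open>S\<close>: by minimality there are edges, hence further vertices, on both sides. The bound
  on \<open>card S\<close> keeps \<open>F\<close> small enough to have a leaf.\<close>
lemma biconn_in_part:
  assumes S: "biconn glue S" and small: "card S * card S \<le> L"
  shows "\<exists>f\<in>E. S \<subseteq> P f"
proof -
  have finS: "finite S" and S2: "2 \<le> card S" and cS: "conn glue S"
    and cSv: "\<And>v. v \<in> S \<Longrightarrow> conn glue (S - {v})" using S by (auto simp: biconn_def)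
  let ?cov = "\<lambda>F. F \<subseteq> E \<and> finite F \<and>
    (\<forall>a\<in>S. \<forall>b\<in>S. {a, b} \<in> edges glue \<longrightarrow> (\<exists>f\<in>F. a \<in> P f \<and> b \<in> P f))"
  define pick where "pick = (\<lambda>(a, b). SOME f. f \<in> E \<and> a \<in> P f \<and> b \<in> P f)"
  define D where "D = {(a, b). a \<in> S \<and> b \<in> S \<and> {a, b} \<in> edges glue}"
  have pick: "pick (a, b) \<in> E \<and> a \<in> P (pick (a, b)) \<and> b \<in> P (pick (a, b))" if "(a, b) \<in> D" for a b
  proof -
    have "\<exists>f. f \<in> E \<and> a \<in> P f \<and> b \<in> P f" using that glue_edge_in_part unfolding D_def by blast
    from someI_ex[OF this] show ?thesis by (simp add: pick_def)
  qed
  have DS: "D \<subseteq> S \<times> S" by (auto simp: D_def)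
  then have finD: "finite D" using finS by (meson finite_SigmaI finite_subset)
  have "card D \<le> card S * card S"
    using card_mono[OF _ DS] finS by (simp add: card_cartesian_product)
  then have "card (pick ` D) \<le> L" using card_image_le[OF finD, of pick] small by linarith
  have cov0: "?cov (pick ` D)"
  proof (intro conjI ballI impI)
    show "pick ` D \<subseteq> E" using pick by fastforce
    show "finite (pick ` D)" using finD by simp
    fix a b assume "a \<in> S" "b \<in> S" "{a, b} \<in> edges glue"
    then have "(a, b) \<in> D" by (simp add: D_def)
    then show "\<exists>f\<in>pick ` D. a \<in> P f \<and> b \<in> P f" using pick by blast
  qed
  then have "\<exists>F. (?cov F \<and> F \<subseteq> pick ` D) \<and> (\<forall>F'. (?cov F' \<and> F' \<subseteq> pick ` D) \<and> F' \<subseteq> F \<longrightarrow> F' = F)"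
    using finD by (intro ex_minimal_set[of "pick ` D" "\<lambda>F. ?cov F \<and> F \<subseteq> pick ` D" "pick ` D"]) auto
  then obtain F where F0: "(?cov F \<and> F \<subseteq> pick ` D) \<and> (\<forall>F'. (?cov F' \<and> F' \<subseteq> pick ` D) \<and> F' \<subseteq> F \<longrightarrow> F' = F)" ..
  have FE: "F \<subseteq> E" and finF: "finite F" using F0 by auto
  have cov: "\<exists>f\<in>F. a \<in> P f \<and> b \<in> P f" if "a \<in> S" "b \<in> S" "{a, b} \<in> edges glue" for a b
    using F0 that by auto
  have FL: "card F \<le> L"
    using card_mono[of "pick ` D" F] F0 finD \<open>card (pick ` D) \<le> L\<close> by simp
  have own_edge: "\<exists>a\<in>S. \<exists>b\<in>S. {a, b} \<in> edges glue \<and> (\<forall>g\<in>F - {f}. \<not> (a \<in> P g \<and> b \<in> P g))"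
    if "f \<in> F" for f
  proof (rule ccontr)
    assume no: "\<not> ?thesis"
    have "\<exists>g\<in>F - {f}. a \<in> P g \<and> b \<in> P g" if "a \<in> S" "b \<in> S" "{a, b} \<in> edges glue" for a b
      using no that by auto
    moreover have "F - {f} \<subseteq> E" "finite (F - {f})" "F - {f} \<subseteq> pick ` D" "F - {f} \<subseteq> F"
      using FE finF F0 by auto
    ultimately have "F - {f} = F" using F0 by simp
    then show False using that by blast
  qed
  have nbr: "\<exists>b\<in>S. {a, b} \<in> edges glue" if a: "a \<in> S" for a
  proof -
    obtain b where "b \<in> S" "b \<noteq> a" using S2 a by (metis One_nat_def card_le_Suc0_iff_eq finS not_less_eq_eq numeral_2_eq_2)
    then obtain a' b' where "a' \<in> {a}" "b' \<in> S - {a}" "{a', b'} \<in> edges glue"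
      using a by (elim connD[OF cS, of "{a}" a b, rotated -1]) auto
    then show ?thesis by auto
  qed
  have in_part: "\<exists>f\<in>F. a \<in> P f" if "a \<in> S" for a using nbr[OF that] cov that by blast
  have "F \<noteq> {}" using in_part S2 by (metis all_not_in_conv card.empty not_numeral_le_zero)
  show ?thesis
  proof (cases "2 \<le> card F")
    case False
    have "card F \<noteq> 0" using finF \<open>F \<noteq> {}\<close> by simp
    then have "card F = 1" using False by linarith
    then obtain f where "F = {f}" by (meson card_1_singletonE)
    then show ?thesis using in_part FE by auto
  next
    case True
    obtain r where "r \<in> F" using \<open>F \<noteq> {}\<close> by blast
    then obtain f where f: "f \<in> F" "leaf P F f" using leaf_exists[OF FE _ True FL] by blast
    define R where "R = (\<Union>g\<in>F - {f}. P g)"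
    have meet: "p = q" if "p \<in> P f \<inter> R" "q \<in> P f \<inter> R" for p q
      using f(2) that unfolding leaf_def R_def by blast
    \<comment> \<open>\<open>S\<close> without the separating vertex, if there is one\<close>
    define Z where "Z = S - P f \<inter> R"
    have cZ: "conn glue Z"
    proof (cases "S \<inter> (P f \<inter> R) = {}")
      case True
      then have "Z = S" by (auto simp: Z_def)
      then show ?thesis using cS by simp
    next
      case False
      then obtain c where c: "c \<in> S" "c \<in> P f \<inter> R" by blast
      then have "Z = S - {c}" using meet unfolding Z_def by blast
      then show ?thesis using cSv c by simp
    qed
    obtain a b where ab: "a \<in> S" "b \<in> S" "{a, b} \<in> edges glue" "\<forall>g\<in>F - {f}. \<not> (a \<in> P g \<and> b \<in> P g)"
      using own_edge[OF f(1)] by blast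
    then have abf: "a \<in> P f" "b \<in> P f" using cov by blast+
    have "a \<noteq> b" using ab(3) glue_edge_in_part by blast
    then have "\<not> (a \<in> R \<and> b \<in> R)" using meet[of a b] abf by blast
    then obtain s where s: "s \<in> S" "s \<in> P f" "s \<notin> R" using ab abf by blast
    have "\<exists>g. g \<in> F \<and> g \<noteq> f"
    proof (rule ccontr)
      assume "\<not> ?thesis"
      then have "F \<subseteq> {f}" by blast
      then have "card F \<le> 1" using card_mono[of "{f}" F] by simp
      then show False using True by simp
    qed
    then obtain g where g: "g \<in> F" "g \<noteq> f" by blast
    obtain a' b' where ab': "a' \<in> S" "b' \<in> S" "{a', b'} \<in> edges glue" "\<forall>h\<in>F - {g}. \<not> (a' \<in> P h \<and> b' \<in> P h)"
      using own_edge[OF g(1)] by blast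
    then have "a' \<in> P g" "b' \<in> P g" using cov by blast+
    then have "a' \<in> R" "b' \<in> R" using g by (auto simp: R_def)
    moreover have "\<not> (a' \<in> P f \<and> b' \<in> P f)" using ab'(4) f(1) g(2) by blast
    ultimately obtain t where t: "t \<in> S" "t \<in> R" "t \<notin> P f" using ab' by blast
    obtain y z where yz: "y \<in> Z \<inter> P f" "z \<in> Z - Z \<inter> P f" "{y, z} \<in> edges glue"
      by (rule connD[OF cZ, of "Z \<inter> P f" s t]) (use s t in \<open>auto simp: Z_def\<close>)
    then obtain h where h: "h \<in> F" "y \<in> P h" "z \<in> P h" using cov[of y z] by (auto simp: Z_def)
    then have False using yz by (cases "h = f") (auto simp: Z_def R_def)
    then show ?thesis ..
  qed
qed

lemma induced_free_glue:
  assumes B: "biconn F S" "card S * card S \<le> L" and free: "induced_free (induced F S) W"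
  shows "induced_free (induced F S) glue"
proof (rule ccontr)
  assume "\<not> ?thesis"
  then obtain \<psi> where \<psi>: "ind_emb \<psi> (induced F S) glue" using not_induced_free_iff by blast
  then obtain f where f: "f \<in> E" "\<psi> ` S \<subseteq> P f"
    using biconn_in_part[of "\<psi> ` S"] biconn_ind_emb[OF \<psi> B(1)] B(2) by auto
  define \<phi> where "\<phi> = inv_into (verts W) (x f) \<circ> \<psi>"
  have \<phi>: "\<phi> u \<in> verts W" "x f (\<phi> u) = \<psi> u" if "u \<in> S" for u
    using that f x_image[OF f(1)] by (auto simp: \<phi>_def inv_into_into f_inv_into_f)
  have "inj_on \<phi> S"
    using \<psi> \<phi>(2) unfolding ind_emb_induced inj_on_def by metis
  moreover have "{u, v} \<in> edges F \<longleftrightarrow> {\<phi> u, \<phi> v} \<in> edges W" if "u \<in> S" "v \<in> S" for u v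
    using glue_edge_iff[OF f(1) \<phi>(1)[OF that(1)] \<phi>(1)[OF that(2)]] \<phi>(2) \<psi> that
    by (simp add: ind_emb_induced)
  ultimately have "ind_emb \<phi> (induced F S) W" using \<phi>(1) by (auto simp: ind_emb_induced)
  then show False using free not_induced_free_iff by blast
qed

end

section \<open>Hypertrees and fresh hyperedges\<close>

context sparse_hypergraph
begin

text \<open>Equality holds exactly for the connected subfamilies, so that counting points detects
  cycles: this is the hypergraph form of counting edges in a forest.\<close>
lemma card_points_ge:
  assumes "1 \<le> n" "F \<subseteq> E" "F \<noteq> {}" "card F \<le> L"
  shows "1 + card F * (n - 1) \<le> card (\<Union>f\<in>F. P f)"
  using assms(2-)
proof (induction "card F" arbitrary: F)
  case 0
  then show ?case using finite_E finite_subset by fastforce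
next
  case (Suc m)
  have finF: "finite F" using Suc.prems finite_E finite_subset by blast
  show ?case
  proof (cases "m = 0")
    case True
    then obtain f where "F = {f}" using Suc.hyps(2) by (metis One_nat_def card_1_singletonE)
    then show ?thesis using Suc.prems card_P assms(1) by simp
  next
    case False
    obtain r where "r \<in> F" using Suc.prems by blast
    then obtain f where f: "f \<in> F" "leaf P F f"
      using leaf_exists[of F r] Suc False by (metis DiffD1 Suc_le_eq Suc_le_mono bot_nat_0.not_eq_extremum numeral_2_eq_2)
    let ?R = "\<Union>g\<in>F - {f}. P g"
    have cF: "card (F - {f}) = m" using Suc.hyps(2) f finF by simp
    then have "F - {f} \<noteq> {}" using False by (metis card.empty)
    then have ih: "1 + m * (n - 1) \<le> card ?R"
      using Suc.hyps(1)[of "F - {f}"] cF Suc.prems Suc.hyps(2) by auto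
    have fin: "finite ?R" "finite (P f)" using finF finite_P Suc.prems f by auto
    have "card (P f \<inter> ?R) \<le> 1"
      using f(2) fin unfolding leaf_def by (auto simp: card_le_Suc0_iff_eq)
    moreover have "card (P f) + card ?R = card (P f \<union> ?R) + card (P f \<inter> ?R)"
      using fin by (intro card_Un_Int) auto
    moreover have "card (P f) = n" using card_P f Suc.prems by blast
    moreover have "card (\<Union>f\<in>F. P f) = card (P f \<union> ?R)"
      using f by (intro arg_cong[of _ _ card]) blast
    moreover have "card F * (n - 1) = m * (n - 1) + (n - 1)" using Suc.hyps(2)[symmetric] by simp
    ultimately show ?thesis using ih assms(1) by linarith
  qed
qed

definition hypertree :: "'e set \<Rightarrow> bool" where
  "hypertree K \<longleftrightarrow> K \<subseteq> E \<and> K \<noteq> {} \<and> card (\<Union>f\<in>K. P f) = 1 + card K * (n - 1)"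

lemma hypertree_singleton:
  assumes "1 \<le> n" "f \<in> E"
  shows "hypertree {f}"
  using assms card_P by (simp add: hypertree_def)

text \<open>A second common point would leave the enlarged family with fewer points than the
  lower bound requires.\<close>
lemma hypertree_insert:
  assumes n: "1 \<le> n" and K: "hypertree K" "card K < L" and f: "f \<in> E - K"
    and p: "p \<in> P f" "p \<in> (\<Union>g\<in>K. P g)"
  shows "P f \<inter> (\<Union>g\<in>K. P g) = {p}" "hypertree (insert f K)"
proof -
  let ?R = "\<Union>g\<in>K. P g"
  have finK: "finite K" using K finite_E finite_subset by (auto simp: hypertree_def)
  have fin: "finite (P f)" "finite ?R" using K f finK finite_P by (auto simp: hypertree_def)
  have sum: "card (P f) + card ?R = card (P f \<union> ?R) + card (P f \<inter> ?R)"
    using fin by (intro card_Un_Int) auto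
  have low: "1 + card (insert f K) * (n - 1) \<le> card (\<Union>g\<in>insert f K. P g)"
    by (rule card_points_ge) (use n K f finK in \<open>auto simp: hypertree_def\<close>)
  have eq: "card (insert f K) * (n - 1) = card K * (n - 1) + (n - 1)" using f finK by simp
  have "0 < card (P f \<inter> ?R)" using p fin by (auto simp: card_gt_0_iff)
  moreover have "card (P f \<inter> ?R) \<le> 1"
    using sum low eq K n f card_P by (simp add: hypertree_def)
  ultimately have one: "card (P f \<inter> ?R) = 1" by linarith
  then obtain q where "P f \<inter> ?R = {q}" by (meson card_1_singletonE)
  moreover have "p \<in> P f \<inter> ?R" using p by simp
  ultimately show "P f \<inter> ?R = {p}" by simp
  show "hypertree (insert f K)"
    using sum one eq K n f card_P unfolding hypertree_def by auto
qed

lemma fresh_hyperedge: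
  assumes "K \<subseteq> E" "card K < d" "p \<in> (\<Union>g\<in>K. P g)"
  obtains f where "f \<in> E - K" "p \<in> P f"
proof -
  obtain g where g: "g \<in> K" "p \<in> P g" using assms by blast
  have "d \<le> card {g \<in> E. p \<in> P g}" using degree[of g p] g assms by blast
  then have "card K < card {g \<in> E. p \<in> P g}" using assms by linarith
  moreover have "finite K" using assms finite_E finite_subset by blast
  ultimately have "\<not> {g \<in> E. p \<in> P g} \<subseteq> K" using card_mono linorder_not_le by blast
  then show thesis using that by blast
qed

end

section \<open>Growing a copy of a graph block by block\<close>

context glued_copies
begin

text \<open>The hyperedge containing such an edge would meet the hypertree \<open>insert f K\<close> in two points.\<close>
lemma no_edge_across:
  assumes K: "hypertree K" "card K + 2 \<le> L" and f: "f \<in> E - K" "P f \<inter> (\<Union>g\<in>K. P g) = {p}"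
    and a: "a \<in> P f" "a \<noteq> p" and b: "b \<in> (\<Union>g\<in>K. P g)" "b \<noteq> p"
  shows "{a, b} \<notin> edges glue"
proof
  assume "{a, b} \<in> edges glue"
  then obtain g where g: "g \<in> E" "a \<in> P g" "b \<in> P g" "a \<noteq> b" by (rule glue_edge_in_part)
  have n: "1 \<le> n" using n_ge_2 by simp
  have "g \<noteq> f" using g b f by blast
  moreover have "g \<notin> K" using g a f by blast
  moreover have "hypertree (insert f K)" by (rule hypertree_insert[OF n K(1) _ f(1), of p]) (use K f in auto)
  moreover have "card (insert f K) < L"
    using K card_insert_le_m1[of "Suc (card K)" K f] finite_subset[OF _ finite_E] f by (auto simp: hypertree_def)
  ultimately have only: "P g \<inter> (\<Union>h\<in>insert f K. P h) = {a}"
    by (intro hypertree_insert(1)[OF n]) (use g a in auto)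
  have "b \<in> P g \<inter> (\<Union>h\<in>insert f K. P h)" using g(3) b(1) by auto
  then show False using g(4) unfolding only by simp
qed

text \<open>The state of the construction: a part \<open>U\<close> of \<open>H\<close> is embedded by \<open>\<phi>\<close> into \<open>glue\<close> minus the edge
  \<open>e\<close>, inside the points of a hypertree \<open>K\<close>. The hypertree contains \<open>f0\<close>, the hyperedge of \<open>e\<close>, so
  that the hyperedges added later contain unharmed copies of \<open>W\<close>. Each step adds at least one vertex
  and at most two hyperedges.\<close>
definition placed :: "'v set \<Rightarrow> 'e \<Rightarrow> 'a ugraph \<Rightarrow> 'a set \<Rightarrow> ('a \<Rightarrow> 'v) \<Rightarrow> 'e set \<Rightarrow> bool" where
  "placed e f0 H U \<phi> K \<longleftrightarrow> U \<subseteq> verts H \<and> tree_closed H U \<and> hypertree K \<and> f0 \<in> K \<and>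
     card K \<le> 1 + 2 * card U \<and> \<phi> ` U \<subseteq> (\<Union>f\<in>K. P f) \<and>
     ind_emb \<phi> (induced H U) (del_edge glue e)"

text \<open>The block \<open>T\<close> goes into the copy of \<open>W\<close> on a fresh hyperedge through \<open>\<phi> v\<close>, by omnipresence with \<open>v\<close>
  at the right place. There are no edges between \<open>T - {v}\<close> and \<open>U - {v}\<close> in \<open>H\<close> as \<open>U\<close> is
  closed, and none between their images by sparsity.\<close>
lemma placed_add_block:
  assumes H: "simple_graph H" and e: "e \<in> edges glue" "e \<subseteq> P f0"
    and K: "placed e f0 H U \<phi> K" and room: "card K + 2 \<le> L" "card K < d"
    and T: "max_biconn H T" "omnipresent (induced H T) W" and v: "v \<in> T" "v \<in> U" and w: "w \<in> T" "w \<notin> U"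
  shows "\<exists>\<phi>' K'. placed e f0 H (U \<union> T) \<phi>' K'"
proof -
  have n: "1 \<le> n" using n_ge_2 by simp
  have U: "U \<subseteq> verts H" "tree_closed H U" "hypertree K" "f0 \<in> K" "card K \<le> 1 + 2 * card U"
    "\<phi> ` U \<subseteq> (\<Union>f\<in>K. P f)" and emb: "ind_emb \<phi> (induced H U) (del_edge glue e)"
    using K by (auto simp: placed_def)
  have KE: "K \<subseteq> E" and f0: "f0 \<in> E" using U by (auto simp: hypertree_def)
  have finK: "finite K" using KE finite_E finite_subset by blast
  have biT: "biconn H T" "T \<subseteq> verts H" using T by (auto simp: max_biconn_def)
  have TU: "T \<inter> U = {v}" using tree_closed_meets_biconn[OF U(2) biT v w] .
  have \<phi>v: "\<phi> v \<in> (\<Union>g\<in>K. P g)" using U(6) v(2) by blast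
  obtain f where f: "f \<in> E - K" "\<phi> v \<in> P f"
    by (rule fresh_hyperedge[OF KE room(2) \<phi>v])
  have meet: "P f \<inter> (\<Union>g\<in>K. P g) = {\<phi> v}" and tree: "hypertree (insert f K)"
    using hypertree_insert[OF n U(3) _ f(1,2) \<phi>v] room by auto
  obtain z where z: "z \<in> verts W" "x f z = \<phi> v" using x_image[of f] f by force
  obtain \<psi> where \<psi>: "ind_emb \<psi> (induced H T) W" "\<psi> v = z"
    using omnipresent_ind_emb[OF T(2), of v z] v z by (auto simp: induced_def)
  define \<phi>' where "\<phi>' t = (if t \<in> U then \<phi> t else x f (\<psi> t))" for t
  have \<psi>W: "\<psi> t \<in> verts W" if "t \<in> T" for t using \<psi>(1) that by (auto simp: ind_emb_induced)
  have \<phi>'T: "\<phi>' t = x f (\<psi> t)" if "t \<in> T" for t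
  proof (cases "t \<in> U")
    case True
    then have "t = v" using that TU by blast
    then show ?thesis using v z \<psi>(2) by (simp add: \<phi>'_def)
  qed (simp add: \<phi>'_def)
  have \<phi>'Tf: "\<phi>' t \<in> P f" if "t \<in> T" for t
    using x_image[of f] f \<psi>W[OF that] \<phi>'T[OF that] by auto
  have \<phi>'U: "\<phi>' t \<in> (\<Union>g\<in>K. P g)" if "t \<in> U" for t using that U by (auto simp: \<phi>'_def)
  have injT: "inj_on \<phi>' T"
  proof (rule inj_onI)
    fix s t assume st: "s \<in> T" "t \<in> T" "\<phi>' s = \<phi>' t"
    then have "\<psi> s = \<psi> t" using \<phi>'T \<psi>W x_inj[of f] f by (metis DiffD1 inj_onD)
    then show "s = t" using st \<psi>(1) unfolding ind_emb_induced by (meson inj_onD)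
  qed
  have injU: "inj_on \<phi>' U" using emb by (auto simp: ind_emb_induced \<phi>'_def inj_on_def)
  have v': "\<phi>' v = \<phi> v" using v by (simp add: \<phi>'_def)
  have off_T: "\<phi>' t \<noteq> \<phi> v" if "t \<in> T - {v}" for t
    using inj_onD[OF injT, of t v] that v v' by auto
  have off_U: "\<phi>' u \<noteq> \<phi> v" if "u \<in> U - {v}" for u
    using inj_onD[OF injU, of u v] that v v' by auto
  have ne: "\<phi>' t \<noteq> \<phi>' u" if "t \<in> T - {v}" "u \<in> U" for t u
    using off_T[OF that(1)] \<phi>'Tf[of t] \<phi>'U[OF that(2)] that(1) meet by auto
  have inj: "inj_on \<phi>' (U \<union> T)"
  proof (rule inj_onI)
    fix s t assume st: "s \<in> U \<union> T" "t \<in> U \<union> T" "\<phi>' s = \<phi>' t"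
    have "s \<in> U \<or> s \<in> T - {v}" "t \<in> U \<or> t \<in> T - {v}" using st v by auto
    then show "s = t" using st(3) ne[of s t] ne[of t s] inj_onD[OF injU st(3)] inj_onD[OF injT st(3)]
      by auto
  qed
  have edgesT: "{s, t} \<in> edges H \<longleftrightarrow> {\<phi>' s, \<phi>' t} \<in> edges (del_edge glue e)" if "s \<in> T" "t \<in> T" for s t
  proof -
    have "{s, t} \<in> edges H \<longleftrightarrow> {\<psi> s, \<psi> t} \<in> edges W"
      using \<psi>(1) that by (simp add: ind_emb_induced)
    also have "\<dots> \<longleftrightarrow> {\<phi>' s, \<phi>' t} \<in> edges glue"
      using glue_edge_iff[of f "\<psi> s" "\<psi> t"] f \<psi>W \<phi>'T that by simp
    also have "\<dots> \<longleftrightarrow> {\<phi>' s, \<phi>' t} \<in> edges (del_edge glue e)"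
    proof -
      have "{\<phi>' s, \<phi>' t} \<noteq> e"
      proof
        assume eq: "{\<phi>' s, \<phi>' t} = e"
        then have "\<phi>' s \<noteq> \<phi>' t" using e(1) glue_edge_in_part by metis
        moreover have "\<phi>' s = \<phi>' t"
          by (rule linear[of f f0]) (use f f0 U \<phi>'Tf that eq e in auto)
        ultimately show False by simp
      qed
      then show ?thesis by (simp add: del_edge_def)
    qed
    finally show ?thesis .
  qed
  have edgesU: "{s, t} \<in> edges H \<longleftrightarrow> {\<phi>' s, \<phi>' t} \<in> edges (del_edge glue e)" if "s \<in> U" "t \<in> U" for s t
    using emb that by (simp add: ind_emb_induced \<phi>'_def)
  have no_H: "{t, u} \<notin> edges H" if "t \<in> T - {v}" "u \<in> U - {v}" for t u
    by (rule no_edge_off_cut_vertex[OF U(2) biT TU that])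
  have no_G: "{\<phi>' t, \<phi>' u} \<notin> edges glue" if "t \<in> T - {v}" "u \<in> U - {v}" for t u
    by (rule no_edge_across[OF U(3) room(1) f(1) meet])
       (use \<phi>'Tf[of t] off_T[of t] off_U[of u] \<phi>'U[of u] that in auto)
  have cross: "{t, u} \<in> edges H \<longleftrightarrow> {\<phi>' t, \<phi>' u} \<in> edges (del_edge glue e)"
    if "t \<in> T - {v}" "u \<in> U - {v}" for t u
    using no_H[OF that] no_G[OF that] by (simp add: del_edge_def)
  have edges: "{s, t} \<in> edges H \<longleftrightarrow> {\<phi>' s, \<phi>' t} \<in> edges (del_edge glue e)" if "s \<in> U \<union> T" "t \<in> U \<union> T" for s t
  proof -
    have "s \<in> U \<and> t \<in> U \<or> s \<in> T \<and> t \<in> T \<or> s \<in> T - {v} \<and> t \<in> U - {v} \<or> t \<in> T - {v} \<and> s \<in> U - {v}"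
      using that v by auto
    then show ?thesis
      using edgesU[of s t] edgesT[of s t] cross[of s t] cross[of t s]
      by (auto simp: insert_commute)
  qed
  have im: "\<phi>' ` (U \<union> T) \<subseteq> (\<Union>g\<in>insert f K. P g)" using \<phi>'U \<phi>'Tf by blast
  have "(\<Union>g\<in>insert f K. P g) \<subseteq> verts (del_edge glue e)"
    using f KE by (auto simp: glue_def del_edge_def)
  then have "\<phi>' ` (U \<union> T) \<subseteq> verts (del_edge glue e)" using im by (rule order_trans[rotated])
  then have "ind_emb \<phi>' (induced H (U \<union> T)) (del_edge glue e)"
    using inj edges unfolding ind_emb_induced by blast
  moreover have "card (insert f K) \<le> 1 + 2 * card (U \<union> T)"
  proof -
    have "finite (U \<union> T)" using H U(1) biT by (auto simp: simple_graph_def intro: finite_subset)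
    then have "card U < card (U \<union> T)" using w by (intro psubset_card_mono) auto
    moreover have "card (insert f K) = Suc (card K)" using f finK by simp
    ultimately show ?thesis using U(5) by linarith
  qed
  moreover have "tree_closed H (U \<union> T)" by (rule tree_closed_add_block[OF H U(2) T(1) TU])
  ultimately have "placed e f0 H (U \<union> T) \<phi>' (insert f K)"
    using U biT tree im unfolding placed_def by auto
  then show ?thesis by blast
qed

text \<open>A vertex of a new component needs a place that is not adjacent to anything
  used so far, yet inside an extended hypertree: leave the hypertree by a fresh hyperedge \<open>f\<close>, then
  leave \<open>f\<close> at a new point \<open>q\<close> by a fresh hyperedge \<open>g\<close>, and take a point of \<open>g\<close> other than \<open>q\<close>.\<close>
lemma placed_add_vertex:
  assumes H: "simple_graph H" 
    and K: "placed e f0 H U \<phi> K" and room: "card K + 3 \<le> L" "card K + 1 < d"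
    and v: "v \<in> verts H" "v \<notin> U"
    and sep: "\<And>u w. u \<in> U \<Longrightarrow> w \<in> verts H - U \<Longrightarrow> {w, u} \<notin> edges H"
  shows "\<exists>\<phi>' K'. placed e f0 H (insert v U) \<phi>' K'"
proof -
  have n: "1 \<le> n" using n_ge_2 by simp
  have U: "U \<subseteq> verts H" "tree_closed H U" "hypertree K" "f0 \<in> K" "card K \<le> 1 + 2 * card U"
    "\<phi> ` U \<subseteq> (\<Union>f\<in>K. P f)" and emb: "ind_emb \<phi> (induced H U) (del_edge glue e)"
    using K by (auto simp: placed_def)
  have KE: "K \<subseteq> E" using U by (auto simp: hypertree_def)
  have finK: "finite K" using KE finite_E finite_subset by blast
  have other: "\<exists>q\<in>P f. q \<noteq> p" if "f \<in> E" for f p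
  proof (rule ccontr)
    assume "\<not> ?thesis"
    then have "P f \<subseteq> {p}" by blast
    then have "card (P f) \<le> 1" using card_mono[of "{p}" "P f"] by simp
    then show False using card_P[OF that] n_ge_2 by simp
  qed
  have "f0 \<in> E" using KE U by blast
  from other[OF this] obtain p where p: "p \<in> (\<Union>g\<in>K. P g)" using U(4) by blast
  obtain f where f: "f \<in> E - K" "p \<in> P f"
    by (rule fresh_hyperedge[OF KE _ p]) (use room in auto)
  have meet: "P f \<inter> (\<Union>g\<in>K. P g) = {p}" and tree: "hypertree (insert f K)"
    using hypertree_insert[OF n U(3) _ f(1,2) p] room by auto
  obtain q where q: "q \<in> P f" "q \<noteq> p" using other[of f p] f by blast
  have cK: "card (insert f K) = Suc (card K)" using f finK by simp
  obtain g where g: "g \<in> E - insert f K" "q \<in> P g"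
    by (rule fresh_hyperedge[of "insert f K" q]) (use f KE room cK q in auto)
  have q_in: "q \<in> (\<Union>h\<in>insert f K. P h)" using q by blast
  have meet': "P g \<inter> (\<Union>h\<in>insert f K. P h) = {q}" and tree': "hypertree (insert g (insert f K))"
    using hypertree_insert[OF n tree _ g(1,2) q_in] room cK by auto
  obtain z where z: "z \<in> P g" "z \<noteq> q" using other[of g q] g by blast
  have q_out: "q \<notin> (\<Union>h\<in>K. P h)" using meet q by blast
  have z_out: "z \<notin> (\<Union>h\<in>K. P h)" using meet' z by blast
  have far: "{z, b} \<notin> edges glue" if "b \<in> (\<Union>h\<in>K. P h)" for b
    by (rule no_edge_across[OF tree _ g(1) meet' z]) (use that q_out cK room in auto)
  define \<phi>' where "\<phi>' = \<phi>(v := z)"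
  have loopH: "{v} \<notin> edges H" and loopG: "{z} \<notin> edges glue"
    using H simple_glue unfolding simple_graph_def by (metis doubleton_eq_iff insert_absorb2)+
  have \<phi>'U: "\<phi>' u = \<phi> u" "\<phi> u \<in> (\<Union>h\<in>K. P h)" if "u \<in> U" for u
    using that v U by (auto simp: \<phi>'_def)
  have \<phi>'v: "\<phi>' v = z" by (simp add: \<phi>'_def)
  have "inj_on \<phi>' (insert v U)"
  proof -
    have "inj_on \<phi>' U" using emb \<phi>'U by (simp add: ind_emb_induced inj_on_def)
    moreover have "\<phi>' v \<notin> \<phi>' ` U"
    proof
      assume "\<phi>' v \<in> \<phi>' ` U"
      then obtain u where "u \<in> U" "z = \<phi> u" using \<phi>'U(1) \<phi>'v by auto
      then show False using \<phi>'U(2)[of u] z_out by simp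
    qed
    ultimately show ?thesis using v by simp
  qed
  moreover have "{s, t} \<in> edges H \<longleftrightarrow> {\<phi>' s, \<phi>' t} \<in> edges (del_edge glue e)"
    if "s \<in> insert v U" "t \<in> insert v U" for s t
  proof -
    have a: "{v, u} \<notin> edges H" "{z, \<phi>' u} \<notin> edges glue" if "u \<in> U" for u
      using sep[OF that] v far \<phi>'U[OF that] by auto
    consider "s \<in> U" "t \<in> U" | "s = v" "t \<in> U" | "s \<in> U" "t = v" | "s = v" "t = v" using \<open>s \<in> _\<close> \<open>t \<in> _\<close> by blast
    then show ?thesis
    proof cases
      case 1
      then show ?thesis using emb \<phi>'U by (simp add: ind_emb_induced)
    next
      case 2
      then show ?thesis using a[of t] \<phi>'v by (simp add: del_edge_def)
    next
      case 3
      then show ?thesis using a[of s] \<phi>'v by (simp add: del_edge_def insert_commute)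
    next
      case 4
      then show ?thesis using loopH loopG \<phi>'v by (simp add: del_edge_def)
    qed
  qed
  moreover have im: "\<phi>' ` insert v U \<subseteq> (\<Union>h\<in>insert g (insert f K). P h)"
    using \<phi>'U \<phi>'v z by auto
  have "(\<Union>h\<in>insert g (insert f K). P h) \<subseteq> verts (del_edge glue e)"
    using f g KE by (auto simp: glue_def del_edge_def)
  then have "\<phi>' ` insert v U \<subseteq> verts (del_edge glue e)" using im by (rule order_trans[rotated])
  ultimately have "ind_emb \<phi>' (induced H (insert v U)) (del_edge glue e)"
    unfolding ind_emb_induced by blast
  moreover have "card (insert g (insert f K)) \<le> 1 + 2 * card (insert v U)"
  proof -
    have "finite U" using H U(1) by (auto simp: simple_graph_def intro: finite_subset)
    then show ?thesis using U(5) v(2) g finK cK by simp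
  qed
  ultimately have "placed e f0 H (insert v U) \<phi>' (insert g (insert f K))"
    using U v tree' im tree_closed_add_vertex[of U H v, OF sep] unfolding placed_def by auto
  then show ?thesis by blast
qed

text \<open>While an edge leaves \<open>U\<close>, its block can be added; otherwise \<open>U\<close> is a union of components and
  a new component can be started. The block \<open>S\<close> is never asked for again, as it lies in \<open>U\<close>.\<close>
lemma placed_extend:
  assumes H: "simple_graph H" and e: "e \<in> edges glue" "e \<subseteq> P f0"
    and omni: "\<And>T. max_biconn H T \<Longrightarrow> T \<noteq> S \<Longrightarrow> omnipresent (induced H T) W"
    and room: "2 * card (verts H) + 4 \<le> L" "2 * card (verts H) + 4 \<le> d"
    and K: "placed e f0 H U \<phi> K" and SU: "S \<subseteq> U"
  shows "\<exists>\<psi>. ind_emb \<psi> H (del_edge glue e)"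
  using K SU
proof (induction "card (verts H) - card U" arbitrary: U \<phi> K rule: less_induct)
  case less
  have fin: "finite (verts H)" using H by (simp add: simple_graph_def)
  have UV: "U \<subseteq> verts H" and cK: "card K \<le> 1 + 2 * card U"
    and emb: "ind_emb \<phi> (induced H U) (del_edge glue e)"
    and closed: "tree_closed H U" using less.prems by (auto simp: placed_def)
  show ?case
  proof (cases "U = verts H")
    case True
    have "ind_emb \<phi> H (del_edge glue e)"
      using emb[unfolded True ind_emb_induced] unfolding ind_emb_def by simp
    then show ?thesis by blast
  next
    case False
    then have "card U < card (verts H)" using UV fin by (intro psubset_card_mono) auto
    then have small: "card K + 3 \<le> L" "card K + 1 < d" using cK room by linarith+
    have grow: ?thesis if U': "U \<subset> U'" "placed e f0 H U' \<phi>' K'" for U' \<phi>' K'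
    proof (rule less.hyps[OF _ U'(2)])
      have "U' \<subseteq> verts H" using U' by (simp add: placed_def)
      then have "card U < card U'" "card U' \<le> card (verts H)"
        using U' fin by (auto intro: psubset_card_mono card_mono finite_subset)
      then show "card (verts H) - card U' < card (verts H) - card U" by linarith
      show "S \<subseteq> U'" using less.prems U' by blast
    qed
    show ?thesis
    proof (cases "\<exists>u\<in>U. \<exists>w\<in>verts H - U. {w, u} \<in> edges H")
      case True
      then obtain u w where uw: "u \<in> U" "w \<in> verts H - U" "{w, u} \<in> edges H" by blast
      obtain T where T: "w \<in> T" "u \<in> T" "max_biconn H T" by (rule edge_in_max_biconn[OF H uw(3)])
      have "T \<noteq> S" using T uw less.prems by blast
      then have "\<exists>\<phi>' K'. placed e f0 H (U \<union> T) \<phi>' K'"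
        using placed_add_block[OF H e less.prems(1) _ _ T(3) omni[OF T(3)] T(2) uw(1) T(1)] uw small by auto
      then obtain \<phi>' K' where "placed e f0 H (U \<union> T) \<phi>' K'" by blast
      then show ?thesis by (rule grow[rotated]) (use T uw in blast)
    next
      case False
      obtain v where v: "v \<in> verts H" "v \<notin> U" using \<open>U \<noteq> verts H\<close> UV by blast
      have "\<exists>\<phi>' K'. placed e f0 H (insert v U) \<phi>' K'"
        by (rule placed_add_vertex[OF H less.prems(1) small v]) (use False in blast)
      then obtain \<phi>' K' where "placed e f0 H (insert v U) \<phi>' K'" by blast
      then show ?thesis by (rule grow[rotated]) (use v in blast)
    qed
  qed
qed

lemma placed_start:
  assumes H: "simple_graph H" and S: "max_biconn H S"
    and e: "f0 \<in> E" "e0 \<in> edges W" and nf: "\<not> induced_free (induced H S) (del_edge W e0)"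
  shows "\<exists>\<phi>. placed (x f0 ` e0) f0 H S \<phi> {f0}"
proof -
  obtain \<psi> where \<psi>: "ind_emb \<psi> (induced H S) (del_edge W e0)" using nf not_induced_free_iff by blast
  obtain a b where ab: "a \<in> verts W" "b \<in> verts W" "e0 = {a, b}" using e(2) by (meson W_edgeE)
  let ?\<phi> = "x f0 \<circ> \<psi>"
  have \<psi>W: "\<psi> t \<in> verts W" if "t \<in> S" for t using \<psi> that by (auto simp: ind_emb_induced del_edge_def)
  have im: "?\<phi> ` S \<subseteq> P f0" using \<psi>W x_image[OF e(1)] by auto
  have "\<psi> ` S \<subseteq> verts W" using \<psi>W by blast
  then have inj: "inj_on ?\<phi> S"
    using \<psi> x_inj[OF e(1)] unfolding ind_emb_induced by (meson comp_inj_on inj_on_subset)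
  have "{s, t} \<in> edges H \<longleftrightarrow> {?\<phi> s, ?\<phi> t} \<in> edges (del_edge glue (x f0 ` e0))" if "s \<in> S" "t \<in> S" for s t
  proof -
    have "x f0 ` {\<psi> s, \<psi> t} = x f0 ` e0 \<longleftrightarrow> {\<psi> s, \<psi> t} = e0"
      by (rule inj_on_image_eq_iff[OF x_inj[OF e(1)]]) (use \<psi>W that ab in auto)
    moreover have "{x f0 (\<psi> s), x f0 (\<psi> t)} \<in> edges glue \<longleftrightarrow> {\<psi> s, \<psi> t} \<in> edges W"
      using glue_edge_iff[OF e(1)] \<psi>W that by blast
    moreover have "{s, t} \<in> edges H \<longleftrightarrow> {\<psi> s, \<psi> t} \<in> edges (del_edge W e0)"
      using \<psi> that by (simp add: ind_emb_induced)
    ultimately show ?thesis by (simp add: del_edge_def)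
  qed
  then have "ind_emb ?\<phi> (induced H S) (del_edge glue (x f0 ` e0))"
    using inj im e(1) unfolding ind_emb_induced by (auto simp: del_edge_def glue_def)
  moreover have "hypertree {f0}" using hypertree_singleton[OF _ e(1)] n_ge_2 by simp
  ultimately have "placed (x f0 ` e0) f0 H S ?\<phi> {f0}"
    using im S max_biconn_tree_closed[OF H S] by (auto simp: placed_def max_biconn_def)
  then show ?thesis by blast
qed

lemma deletion_saturated_glue:
  assumes H: "simple_graph H" and S: "max_biconn H S"
    and sat: "deletion_saturated (induced H S) W"
    and omni: "\<And>T. max_biconn H T \<Longrightarrow> T \<noteq> S \<Longrightarrow> omnipresent (induced H T) W"
    and room: "2 * card (verts H) + 4 \<le> L" "2 * card (verts H) + 4 \<le> d"
      "card (verts H) * card (verts H) \<le> L"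
  shows "deletion_saturated H glue"
  unfolding deletion_saturated_def
proof (intro conjI ballI simple_glue glue_nonempty)
  have fin: "finite (verts H)" using H by (simp add: simple_graph_def)
  have SV: "S \<subseteq> verts H" "biconn H S" using S by (auto simp: max_biconn_def)
  have "card S \<le> card (verts H)" using SV fin by (simp add: card_mono)
  then have "card S * card S \<le> card (verts H) * card (verts H)" by (simp add: mult_le_mono)
  then have "card S * card S \<le> L" using room by linarith
  then have free: "induced_free (induced H S) glue"
    using induced_free_glue SV sat by (auto simp: deletion_saturated_def)
  show "induced_free H glue"
  proof (rule ccontr)
    assume "\<not> ?thesis"
    then obtain \<psi> where \<psi>: "ind_emb \<psi> H glue" using not_induced_free_iff by blast
    have "inj_on \<psi> S" using \<psi> SV unfolding ind_emb_def by (meson inj_on_subset)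
    then have "ind_emb \<psi> (induced H S) glue"
      using \<psi> SV unfolding ind_emb_induced by (auto simp: ind_emb_def)
    then show False using free not_induced_free_iff by blast
  qed
  fix e assume e: "e \<in> edges glue"
  then obtain f0 e0 where f0: "f0 \<in> E" "e0 \<in> edges W" "e = x f0 ` e0" by (auto simp: glue_def)
  have "\<not> induced_free (induced H S) (del_edge W e0)" using sat f0 by (simp add: deletion_saturated_def)
  then obtain \<phi> where "placed e f0 H S \<phi> {f0}" using placed_start[OF H S f0(1,2)] f0(3) by blast
  moreover have "e \<subseteq> P f0" using f0 x_image[OF f0(1)] by (auto elim!: W_edgeE)
  ultimately have "\<exists>\<psi>. ind_emb \<psi> H (del_edge glue e)"
    using placed_extend[OF H e _ omni room(1,2)] by blast
  then show "\<not> induced_free H (del_edge glue e)" using not_induced_free_iff by blast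
qed

end

section \<open>Graphs with a governing block\<close>

text \<open>A one-vertex graph embeds into each nonempty graph, so nothing is saturated for it.\<close>
lemma block_of_saturated_not_trivial:
  assumes H: "simple_graph H" and S: "induced H S \<in> blocks H"
    and sat: "deletion_saturated (induced H S) W"
  shows "2 \<le> card S"
proof (rule ccontr)
  assume "\<not> 2 \<le> card S"
  moreover have "two_connected (induced H S)" using S by (auto simp: blocks_def)
  ultimately have "card S = 1" by (auto simp: two_connected_def induced_def)
  then obtain v where v: "S = {v}" by (meson card_1_singletonE)
  have W: "simple_graph W" "edges W \<noteq> {}" using sat by (auto simp: deletion_saturated_def)
  then obtain w where w: "w \<in> verts W" unfolding simple_graph_def by blast
  have loop: "{y} \<notin> edges G" if "simple_graph G" for y and G :: "'z ugraph"
    using that unfolding simple_graph_def by (metis doubleton_eq_iff insert_absorb2)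
  have "ind_emb (\<lambda>_. w) (induced H S) W"
    using loop[OF H] loop[OF W(1)] w v by (simp add: ind_emb_induced)
  then show False using sat not_induced_free_iff unfolding deletion_saturated_def by blast
qed

theorem theorem4p1:
  fixes H :: "'a ugraph"
  assumes "simple_graph H"
    and "\<exists>B. governing_block H B"
  shows "deletion_normal H"
proof -
  obtain B and W :: "nat ugraph" where B: "B \<in> blocks H" "deletion_saturated B W"
    "\<forall>B'\<in>blocks H - {B}. omnipresent B' W"
    using assms(2) unfolding governing_block_def by blast
  obtain S where S: "B = induced H S" using B(1) by (auto simp: blocks_def)
  have S2: "2 \<le> card S" using block_of_saturated_not_trivial[OF assms(1)] B S by blast
  then have maxS: "max_biconn H S" using max_biconn_block[OF assms(1)] B S by blast
  have omni: "omnipresent (induced H T) W" if "max_biconn H T" "T \<noteq> S" for T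
  proof -
    have "2 \<le> card T" using that by (simp add: max_biconn_def biconn_def)
    then have "induced H T \<in> blocks H" using max_biconn_block[OF assms(1)] that by blast
    moreover have "induced H T \<noteq> B" using that S by (auto simp: induced_def)
    ultimately show ?thesis using B by blast
  qed
  have W: "simple_graph W" "edges W \<noteq> {}" using B by (auto simp: deletion_saturated_def)
  \<comment> \<open>A hypertree has at most \<open>2 * h - 1\<close> hyperedges before the last step of the embedding, which is
    why \<open>2 * h + 4\<close> bounds all uses of degree and sparsity there; a copy of the governing block has at
    most \<open>h * h\<close> edges to be covered.\<close>
  define h where "h = card (verts H)"
  obtain E P where "sparse_hypergraph (card (verts W)) (2 * h + 4) (h * h + 2 * h + 4) (E :: nat set) (P :: nat \<Rightarrow> nat set)"
    using sparse_hypergraph_exists by blast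
  then interpret sparse_hypergraph "card (verts W)" "2 * h + 4" "h * h + 2 * h + 4" E P .
  have "\<exists>b. bij_betw b (verts W) (P f)" if "f \<in> E" for f
    using W(1) finite_P[OF that] card_P[OF that] by (intro finite_same_card_bij) (auto simp: simple_graph_def)
  then obtain x where x: "bij_betw (x f) (verts W) (P f)" if "f \<in> E" for f by metis
  interpret glued_copies "card (verts W)" "2 * h + 4" "h * h + 2 * h + 4" E P W x
    by unfold_locales (use W x in auto)
  have "deletion_saturated H glue"
    by (rule deletion_saturated_glue[OF assms(1) maxS _ omni]) (use B S in \<open>auto simp: h_def\<close>)
  then show ?thesis unfolding deletion_normal_def by blast
qed

end
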